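(* Consider the polynomials \[\varphi_2(z) = z_1^2+ a z_1 z_2 + z_2^2 \qquad \text{and}\qquad \varphi_3(z) = z_1^3 + b z_1^2 z_2 + b z_1 z_2^2 + z_2^3\] in $H^2(\mathbb{T}^2)$, where $a$ and $b$ are nonnegative real numbers. The Hankel operator (a) $\mathbf{H}_{\varphi_2}$ has minimal norm if and only if $a\leq 1/2$, (b) $\mathbf{H}_{\varphi_3}$ has minimal norm if and only if $b\leq \sqrt{2}-1$.
   Context: $\mathbb{T}^2$ is the two-dimensional torus with its normalized Haar measure. $H^2(\mathbb{T}^2)$ is the subspace of $L^2(\mathbb{T}^2)$ of functions whose Fourier coefficients are supported on $\mathbb{N}_0^2$, $\mathbb{N}_0=\{0,1,2,\ldots\}$, and $\overline{H^2}(\mathbb{T}^2)$ is the subspace of complex conjugates of functions in $H^2(\mathbb{T}^2)$. Let $\overline{P}$ be the orthogonal projection from $L^2(\mathbb{T}^2)$ to $\overline{H^2}(\mathbb{T}^2)$. For a polynomial $\varphi$ in $H^2(\mathbb{T}^2)$ the (small) Hankel operator $\mathbf{H}_\varphi\colon H^2(\mathbb{T}^2)\to\overline{H^2}(\mathbb{T}^2)$ is the bounded operator $\mathbf{H}_\varphi f = \overline{P}(\overline{\varphi} f)$. One always has $\|\mathbf{H}_\varphi\|\geq\|\varphi\|_{H^2(\mathbb{T}^2)}$, and $\mathbf{H}_\varphi$ is said to have minimal norm if $\|\mathbf{H}_\varphi\|=\|\varphi\|_{H^2(\mathbb{T}^2)}$. *)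

theory Defs
  imports "HOL-Analysis.Analysis"
begin

definition circle_measure :: "complex measure" where
  "circle_measure =
     distr (uniform_measure lborel {0..<2 * pi}) (restrict_space borel (sphere 0 1)) cis"

definition torus2 :: "(complex \<times> complex) measure" where
  "torus2 = circle_measure \<Otimes>\<^sub>M circle_measure"

text \<open>Elements of L2 and of its subspaces are represented by functions; they are not identified
  when they agree almost everywhere.  The sets below are closed under almost everywhere equality
  (within the measurable functions), and the norm and the inner product respect it.\<close>

definition L2_torus :: "(complex \<times> complex \<Rightarrow> complex) set" where
  "L2_torus = {f \<in> borel_measurable torus2. integrable torus2 (\<lambda>z. (norm (f z))\<^sup>2)}"

definition inner_L2 ::
    "(complex \<times> complex \<Rightarrow> complex) \<Rightarrow> (complex \<times> complex \<Rightarrow> complex) \<Rightarrow> complex" where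
  "inner_L2 f g = (LINT z|torus2. f z * cnj (g z))"

definition norm_L2 :: "(complex \<times> complex \<Rightarrow> complex) \<Rightarrow> real" where
  "norm_L2 f = sqrt (LINT z|torus2. (norm (f z))\<^sup>2)"

definition fourier_coeff :: "(complex \<times> complex \<Rightarrow> complex) \<Rightarrow> int \<Rightarrow> int \<Rightarrow> complex" where
  "fourier_coeff f m n = inner_L2 f (\<lambda>z. fst z powi m * snd z powi n)"

definition H2 :: "(complex \<times> complex \<Rightarrow> complex) set" where
  "H2 = {f \<in> L2_torus. \<forall>m n. fourier_coeff f m n \<noteq> 0 \<longrightarrow> 0 \<le> m \<and> 0 \<le> n}"

definition conj_H2 :: "(complex \<times> complex \<Rightarrow> complex) set" where
  "conj_H2 = (\<lambda>f z. cnj (f z)) ` H2"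

text \<open>Since the conjugate Hardy space is a closed subspace, the projection of every square
  integrable function exists, and it is unique up to almost everywhere equality.  Hence
  \<open>norm_L2 (proj_conj_H2 f)\<close> does not depend on the representative that is chosen.\<close>

definition proj_conj_H2 ::
    "(complex \<times> complex \<Rightarrow> complex) \<Rightarrow> complex \<times> complex \<Rightarrow> complex" where
  "proj_conj_H2 f =
     (SOME g. g \<in> conj_H2 \<and> (\<forall>h\<in>conj_H2. inner_L2 (\<lambda>z. f z - g z) h = 0))"

definition hankel ::
    "(complex \<times> complex \<Rightarrow> complex) \<Rightarrow> (complex \<times> complex \<Rightarrow> complex)
      \<Rightarrow> complex \<times> complex \<Rightarrow> complex" where
  "hankel \<phi> f = proj_conj_H2 (\<lambda>z. cnj (\<phi> z) * f z)"

text \<open>The supremum is that of a bounded set whenever \<open>\<phi>\<close> is bounded on the torus, in particular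
  for polynomials.  For a general \<open>\<phi>\<close> in the Hardy space the operator need not be bounded, and
  the definition is not meant to be used.\<close>

definition hankel_norm :: "(complex \<times> complex \<Rightarrow> complex) \<Rightarrow> real" where
  "hankel_norm \<phi> = (SUP f \<in> {f \<in> H2. norm_L2 f \<le> 1}. norm_L2 (hankel \<phi> f))"

definition hankel_minimal_norm :: "(complex \<times> complex \<Rightarrow> complex) \<Rightarrow> bool" where
  "hankel_minimal_norm \<phi> \<longleftrightarrow> hankel_norm \<phi> = norm_L2 \<phi>"

definition phi2 :: "real \<Rightarrow> complex \<times> complex \<Rightarrow> complex" where
  "phi2 a = (\<lambda>(z1, z2). z1 ^ 2 + of_real a * z1 * z2 + z2 ^ 2)"

definition phi3 :: "real \<Rightarrow> complex \<times> complex \<Rightarrow> complex" where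
  "phi3 b = (\<lambda>(z1, z2). z1 ^ 3 + of_real b * z1 ^ 2 * z2 + of_real b * z1 * z2 ^ 2 + z2 ^ 3)"

end

theory Submission
  imports Defs "HOL-Probability.Probability_Measure"
begin

text \<open>
  For a homogeneous symbol \<open>\<Sum>j\<le>d. c j z1^j z2^(d-j)\<close> the Hankel operator maps homogeneous
  polynomials of degree \<open>k \<le> d\<close> to conjugates of homogeneous polynomials of degree \<open>d - k\<close>, and it
  annihilates everything of degree larger than \<open>d\<close>. On degree \<open>k\<close> it is the Hankel
  matrix \<open>(c (p + m))\<close> with \<open>p \<le> d - k\<close> and \<open>m \<le> k\<close>. The norm is thus the largest of the
  norms of \<open>d + 1\<close> finite matrices, and the block \<open>k = 0\<close> is a single column of
  norm \<open>\<parallel>\<phi>\<parallel>\<close>. Hence the norm is minimal iff no other block has a larger norm. For \<open>d = 2\<close> the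
  critical block \<open>k = 1\<close> has norm \<open>1 + a\<close>, and for \<open>d = 3\<close> the critical blocks \<open>k = 1, 2\<close> have squared
  norm \<open>1 + 2b + 3b^2\<close>. The vector \<open>(1, 1)\<close> attains the norm of the block \<open>k = 1\<close> in both cases.

  That the projection can be computed from Fourier coefficients rests on the completeness of the
  trigonometric system, which follows from the Stone-Weierstrass theorem.
\<close>

section \<open>Fourier analysis on the torus\<close>

abbreviation torus :: "(complex \<times> complex) set" where
  "torus \<equiv> sphere 0 1 \<times> sphere 0 1"

text \<open>The characters of the torus. A single index in \<open>int \<times> int\<close> lets
  frequencies be added and negated as group elements.\<close>

definition monom2 :: "int \<times> int \<Rightarrow> complex \<times> complex \<Rightarrow> complex" where
  "monom2 \<alpha> z = fst z powi fst \<alpha> * snd z powi snd \<alpha>"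

text \<open>The square of \<open>norm_L2\<close>, in which Pythagoras and Bessel are free of
  roots.\<close>

definition sqnorm :: "(complex \<times> complex \<Rightarrow> complex) \<Rightarrow> real" where
  "sqnorm f = (LINT z|torus2. (norm (f z))\<^sup>2)"

section \<open>The torus as a Borel probability space, and integrals of characters\<close>

lemma measurable_cis_circle:
  "cis \<in> uniform_measure lborel {0..<2 * pi} \<rightarrow>\<^sub>M restrict_space borel (sphere 0 1)"
proof -
  have "continuous_on UNIV cis"
    by (intro continuous_intros)
  then have "cis \<in> borel \<rightarrow>\<^sub>M borel"
    by (rule borel_measurable_continuous_onI)
  then have "cis \<in> uniform_measure lborel {0..<2 * pi} \<rightarrow>\<^sub>M borel"
    by simp
  then show ?thesis
    by (intro measurable_restrict_space2) auto
qed

lemma prob_space_circle: "prob_space circle_measure"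
  unfolding circle_measure_def
  by (intro prob_space.prob_space_distr prob_space_uniform_measure measurable_cis_circle) auto

lemma space_circle [simp]: "space circle_measure = sphere 0 1"
  by (simp add: circle_measure_def space_restrict_space)

lemma sets_circle [measurable_cong, simp]: "sets circle_measure = sets (restrict_space borel (sphere 0 1))"
  by (simp add: circle_measure_def)

interpretation circle: prob_space circle_measure
  by (rule prob_space_circle)

interpretation circle2: pair_prob_space circle_measure circle_measure ..

lemma prob_space_torus2: "prob_space torus2"
  unfolding torus2_def by (rule circle2.prob_space_axioms)

interpretation torus2: prob_space torus2
  by (rule prob_space_torus2)

lemma space_torus2 [simp]: "space torus2 = torus"
  by (simp add: torus2_def space_pair_measure)

text \<open>Makes continuous functions on the torus measurable and measurable sets traces of Borel
  sets. It rests on \<open>borel_prod\<close> for the ambient plane.\<close>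

lemma sets_torus2: "sets torus2 = sets (restrict_space borel torus)"
proof
  show "sets torus2 \<subseteq> sets (restrict_space borel torus)"
    unfolding torus2_def
  proof (rule sets_pair_in_sets)
    fix a b :: "complex set"
    assume "a \<in> sets circle_measure" "b \<in> sets circle_measure"
    then obtain a' b' where ab: "a' \<in> sets borel" "b' \<in> sets borel"
      "a = sphere 0 1 \<inter> a'" "b = sphere 0 1 \<inter> b'"
      by (auto simp: sets_restrict_space)
    have "a' \<times> b' \<in> sets (borel \<Otimes>\<^sub>M borel)"
      using ab by auto
    then have "a' \<times> b' \<in> sets borel"
      unfolding borel_prod .
    moreover have "a \<times> b = torus \<inter> (a' \<times> b')"
      using ab by auto
    ultimately show "a \<times> b \<in> sets (restrict_space borel torus)"
      unfolding sets_restrict_space by (rule rev_image_eqI)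
  qed
next
  have c: "(\<lambda>x. x) \<in> circle_measure \<rightarrow>\<^sub>M borel"
    unfolding circle_measure_def by (simp add: measurable_restrict_space1)
  have "(\<lambda>z. (fst z, snd z)) \<in> torus2 \<rightarrow>\<^sub>M borel \<Otimes>\<^sub>M borel"
    unfolding torus2_def
    by (intro measurable_Pair measurable_compose[OF measurable_fst c]
          measurable_compose[OF measurable_snd c])
  then have *: "(\<lambda>z. z) \<in> torus2 \<rightarrow>\<^sub>M borel"
    unfolding borel_prod by simp
  show "sets (restrict_space borel torus) \<subseteq> sets torus2"
  proof
    fix X assume "X \<in> sets (restrict_space borel torus)"
    then obtain C where C: "C \<in> sets borel" "X = torus \<inter> C"
      by (auto simp: sets_restrict_space)
    have "(\<lambda>z. z) -` C \<inter> space torus2 \<in> sets torus2"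
      using measurable_sets[OF * C(1)] .
    then show "X \<in> sets torus2"
      using C by (simp add: Int_commute)
  qed
qed

lemma compact_torus: "compact torus"
  by (intro compact_Times compact_sphere)

lemma continuous_imp_measurable_torus2:
  fixes f :: "complex \<times> complex \<Rightarrow> complex"
  assumes "continuous_on torus f"
  shows "f \<in> borel_measurable torus2"
  using borel_measurable_continuous_on_restrict[OF assms]
  by (simp cong: measurable_cong_sets add: sets_torus2)

text \<open>In the angle \<open>t\<close> the integrand is \<open>cis (n * t)\<close>, which for
  \<open>n \<noteq> 0\<close> has a periodic antiderivative.\<close>

lemma circle_integral_powi:
  "(LINT z|circle_measure. z powi n) = (if n = 0 then 1 else 0)"
proof (cases "n = 0")
  case True
  then show ?thesis using circle.prob_space by simp
next
  case False
  have c: "(\<lambda>t. cis (of_int n * t)) \<in> borel_measurable borel"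
    by (intro borel_measurable_continuous_onI continuous_intros)
  have m: "(\<lambda>z::complex. z powi n) \<in> borel_measurable (restrict_space borel (sphere 0 1))"
    by (intro borel_measurable_continuous_on_restrict continuous_intros) auto
  have "(LINT z|circle_measure. z powi n) = (LINT t|uniform_measure lborel {0..<2 * pi}. cis t powi n)"
    unfolding circle_measure_def by (rule integral_distr[OF measurable_cis_circle m])
  also have "uniform_measure lborel {0..<2 * pi} =
      density lborel (\<lambda>t. ennreal (indicator {0..<2 * pi} t / (2 * pi)))"
    unfolding uniform_measure_def
    using divide_ennreal[of 1 "2 * pi"]
    by (intro arg_cong2[where f=density] ext) (simp_all add: indicator_def)
  also have "(LINT t|\<dots>. cis t powi n) =
      (LINT t|lborel. (indicator {0..<2 * pi} t / (2 * pi)) *\<^sub>R cis (of_int n * t))"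
    unfolding cis_power_int
    by (rule integral_density)
       (auto intro!: borel_measurable_continuous_onI continuous_intros)
  \<comment> \<open>Adding the endpoint \<open>2 * pi\<close>, a null set, gives the compact
    interval needed for the fundamental theorem of calculus.\<close>
  also have "\<dots> = (LINT t|lborel. (1 / (2 * pi)) *\<^sub>R (indicator {0..2 * pi} t *\<^sub>R cis (of_int n * t)))"
    by (rule integral_cong_AE)
       (use c in measurable, use AE_lborel_singleton[of "2 * pi"] in
          \<open>auto elim!: eventually_mono simp: indicator_def\<close>)
  also have "\<dots> = (1 / (2 * pi)) *\<^sub>R (LINT t|lborel. indicator {0..2 * pi} t *\<^sub>R cis (of_int n * t))"
    by (rule integral_scaleR_right) 
  also have "(LINT t|lborel. indicator {0..2 * pi} t *\<^sub>R cis (of_int n * t)) =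
      cis (of_int n * (2 * pi)) / (\<i> * of_int n) - cis (of_int n * 0) / (\<i> * of_int n)"
  proof (rule integral_FTC_Icc)
    show "continuous_on {0..2 * pi} (\<lambda>t. cis (of_int n * t))"
      by (intro continuous_intros)
    fix x :: real
    show "((\<lambda>t. cis (of_int n * t) / (\<i> * of_int n)) has_vector_derivative cis (of_int n * x))
        (at x within {0..2 * pi})"
      unfolding cis_conv_exp of_real_mult
      by (rule has_vector_derivative_at_within, rule has_vector_derivative_real_field)
         (use False in \<open>auto intro!: derivative_eq_intros simp: algebra_simps\<close>)
  qed simp
  also have "\<dots> = 0"
    using cis_multiple_2pi[of "of_int n"] by (simp add: mult_ac)
  finally show ?thesis using False by simp
qed

lemma continuous_on_monom2 [continuous_intros]: "continuous_on torus (monom2 \<alpha>)"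
  unfolding monom2_def by (intro continuous_intros) auto

lemma monom2_mult: "z \<in> torus \<Longrightarrow> monom2 \<alpha> z * monom2 \<beta> z = monom2 (\<alpha> + \<beta>) z"
  by (subst (3) monom2_def, subst fst_add, subst snd_add, subst (1 2) power_int_add)
     (auto simp: monom2_def)

text \<open>On the unit circle conjugation is inversion.\<close>

lemma cnj_monom2: "z \<in> torus \<Longrightarrow> cnj (monom2 \<alpha> z) = monom2 (- \<alpha>) z"
proof -
  assume z: "z \<in> torus"
  have "cnj w = inverse w" if "w \<in> sphere 0 1" for w :: complex
    using that by (simp add: inverse_eq_divide divide_conv_cnj)
  with z have "cnj (fst z) = inverse (fst z)" "cnj (snd z) = inverse (snd z)"
    by (auto simp: mem_Times_iff)
  then show ?thesis
    by (simp add: monom2_def power_int_minus power_int_inverse)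
qed

lemma fourier_coeff_eq: "fourier_coeff f m n = inner_L2 f (monom2 (m, n))"
  unfolding fourier_coeff_def monom2_def[abs_def] by simp

section \<open>Square integrable functions and their inner product\<close>

lemma L2_torusD:
  assumes "f \<in> L2_torus"
  shows "f \<in> borel_measurable torus2" "integrable torus2 (\<lambda>z. (norm (f z))\<^sup>2)"
  using assms by (auto simp: L2_torus_def)

lemma continuous_bounded_torus:
  assumes "continuous_on torus (f :: _ \<Rightarrow> complex)"
  obtains B where "\<And>z. z \<in> torus \<Longrightarrow> norm (f z) \<le> B"
proof -
  have "bounded (f ` torus)"
    by (intro compact_imp_bounded compact_continuous_image assms compact_torus)
  then show ?thesis
    using that unfolding bounded_iff by auto
qed

lemma L2_torus_bounded:
  assumes [measurable]: "f \<in> borel_measurable torus2" and "\<And>z. z \<in> torus \<Longrightarrow> norm (f z) \<le> B"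
  shows "f \<in> L2_torus"
  unfolding L2_torus_def
proof (intro CollectI conjI)
  show "integrable torus2 (\<lambda>z. (norm (f z))\<^sup>2)"
    by (rule torus2.integrable_const_bound[where B="B\<^sup>2"])
       (use assms(2) in \<open>auto intro!: AE_I2 power_mono\<close>)
qed fact

lemma L2_torus_continuous:
  assumes "continuous_on torus f"
  shows "f \<in> L2_torus"
  by (rule continuous_bounded_torus[OF assms])
     (rule L2_torus_bounded[OF continuous_imp_measurable_torus2[OF assms]])

lemma L2_torus_dominated:
  assumes "f \<in> borel_measurable torus2" "g \<in> L2_torus"
    and "\<And>z. z \<in> torus \<Longrightarrow> norm (f z) \<le> C * norm (g z)"
  shows "f \<in> L2_torus"
  unfolding L2_torus_def
proof (intro CollectI conjI)
  show "integrable torus2 (\<lambda>z. (norm (f z))\<^sup>2)"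
  proof (rule Bochner_Integration.integrable_bound)
    show "integrable torus2 (\<lambda>z. C\<^sup>2 * (norm (g z))\<^sup>2)"
      by (intro integrable_mult_right L2_torusD assms)
    show "AE z in torus2. norm ((norm (f z))\<^sup>2) \<le> norm (C\<^sup>2 * (norm (g z))\<^sup>2)"
      using assms(3) by (auto intro!: AE_I2 power_mono simp flip: power_mult_distrib)
  qed (use assms(1) in measurable)
qed fact

lemma norm_add_sq_le:
  fixes a b :: "'a::real_normed_vector"
  shows "(norm (a + b))\<^sup>2 \<le> 2 * (norm a)\<^sup>2 + 2 * (norm b)\<^sup>2"
proof -
  have "(norm (a + b))\<^sup>2 \<le> (norm a + norm b)\<^sup>2"
    by (intro power_mono norm_triangle_ineq) auto
  also have "\<dots> \<le> 2 * (norm a)\<^sup>2 + 2 * (norm b)\<^sup>2"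
    \<comment> \<open>This is \<open>(norm a - norm b)\<^sup>2 \<ge> 0\<close>.\<close>
    using sum_squares_ge_zero[of "norm a - norm b" 0] by (simp add: power2_eq_square algebra_simps)
  finally show ?thesis .
qed

lemma L2_torus_add:
  assumes "f \<in> L2_torus" "g \<in> L2_torus"
  shows "(\<lambda>z. f z + g z) \<in> L2_torus"
  unfolding L2_torus_def
proof (intro CollectI conjI)
  note [measurable] = L2_torusD(1)[OF assms(1)] L2_torusD(1)[OF assms(2)]
  show "(\<lambda>z. f z + g z) \<in> borel_measurable torus2"
    by measurable
  show "integrable torus2 (\<lambda>z. (norm (f z + g z))\<^sup>2)"
  proof (rule Bochner_Integration.integrable_bound)
    show "integrable torus2 (\<lambda>z. 2 * (norm (f z))\<^sup>2 + 2 * (norm (g z))\<^sup>2)"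
      by (intro integrable_mult_right Bochner_Integration.integrable_add L2_torusD assms)
    show "AE z in torus2. norm ((norm (f z + g z))\<^sup>2) \<le> norm (2 * (norm (f z))\<^sup>2 + 2 * (norm (g z))\<^sup>2)"
      by (intro AE_I2) (use norm_add_sq_le in auto)
  qed measurable
qed

lemma L2_torus_mult_continuous:
  assumes p: "continuous_on torus p" and f: "f \<in> L2_torus"
  shows "(\<lambda>z. p z * f z) \<in> L2_torus"
proof -
  obtain B where B: "\<And>z. z \<in> torus \<Longrightarrow> norm (p z) \<le> B"
    using continuous_bounded_torus[OF p] by blast
  note [measurable] = L2_torusD(1)[OF f] continuous_imp_measurable_torus2[OF p]
  show ?thesis
  proof (rule L2_torus_dominated[OF _ f])
    show "norm (p z * f z) \<le> B * norm (f z)" if "z \<in> torus" for z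
      using B[OF that] by (simp add: norm_mult mult_right_mono)
  qed measurable
qed

lemma L2_torus_cmult: "f \<in> L2_torus \<Longrightarrow> (\<lambda>z. c * f z) \<in> L2_torus"
  by (intro L2_torus_mult_continuous continuous_intros)

lemma L2_torus_diff: "f \<in> L2_torus \<Longrightarrow> g \<in> L2_torus \<Longrightarrow> (\<lambda>z. f z - g z) \<in> L2_torus"
  using L2_torus_add[OF _ L2_torus_cmult[of g "-1"], of f] by simp

lemma L2_torus_cnj: "f \<in> L2_torus \<Longrightarrow> (\<lambda>z. cnj (f z)) \<in> L2_torus"
  using measurable_compose[OF L2_torusD(1) borel_measurable_continuous_onI[OF continuous_on_cnj[OF continuous_on_id]]]
  by (simp add: L2_torus_def)

lemma L2_torus_integrable_mult:
  assumes "f \<in> L2_torus" "g \<in> L2_torus"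
  shows "integrable torus2 (\<lambda>z. f z * g z)"
proof (rule Bochner_Integration.integrable_bound)
  note [measurable] = L2_torusD(1)[OF assms(1)] L2_torusD(1)[OF assms(2)]
  show "integrable torus2 (\<lambda>z. (norm (f z))\<^sup>2 + (norm (g z))\<^sup>2)"
    by (intro Bochner_Integration.integrable_add L2_torusD assms)
  have "a * b \<le> a\<^sup>2 + b\<^sup>2" for a b :: real
    using sum_squares_bound[of a b] zero_le_power2[of a] zero_le_power2[of b]
    unfolding mult.assoc by linarith
  then show "AE z in torus2. norm (f z * g z) \<le> norm ((norm (f z))\<^sup>2 + (norm (g z))\<^sup>2)"
    by (intro AE_I2) (simp add: norm_mult)
  show "(\<lambda>z. f z * g z) \<in> borel_measurable torus2"
    by measurable
qed

lemma L2_torus_integrable_cnj: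
  "f \<in> L2_torus \<Longrightarrow> g \<in> L2_torus \<Longrightarrow> integrable torus2 (\<lambda>z. f z * cnj (g z))"
  by (intro L2_torus_integrable_mult L2_torus_cnj)

lemma inner_L2_cnj: "cnj (inner_L2 f g) = inner_L2 g f"
  unfolding inner_L2_def
  by (subst Bochner_Integration.integral_cnj[symmetric], rule Bochner_Integration.integral_cong) simp_all

lemma inner_L2_self: "inner_L2 f f = of_real (sqnorm f)"
  unfolding inner_L2_def sqnorm_def integral_complex_of_real[symmetric] complex_norm_square ..

lemma sqnorm_nonneg [simp]: "0 \<le> sqnorm f"
  by (simp add: sqnorm_def)

lemma norm_L2_eq: "norm_L2 f = sqrt (sqnorm f)"
  by (simp add: norm_L2_def sqnorm_def)

lemma inner_L2_diff_left:
  "f \<in> L2_torus \<Longrightarrow> g \<in> L2_torus \<Longrightarrow> h \<in> L2_torus \<Longrightarrow>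
    inner_L2 (\<lambda>z. f z - g z) h = inner_L2 f h - inner_L2 g h"
  unfolding inner_L2_def left_diff_distrib
  by (intro Bochner_Integration.integral_diff L2_torus_integrable_cnj)

lemma inner_L2_diff_right:
  assumes "f \<in> L2_torus" "g \<in> L2_torus" "h \<in> L2_torus"
  shows "inner_L2 h (\<lambda>z. f z - g z) = inner_L2 h f - inner_L2 h g"
  using inner_L2_diff_left[OF assms] by (metis complex_cnj_diff inner_L2_cnj)

text \<open>A triangle inequality up to constants. The factors 2 are absorbed by splitting errors
  into quarters.\<close>

lemma sqnorm_add_le:
  assumes "f \<in> L2_torus" "g \<in> L2_torus"
  shows "sqnorm (\<lambda>z. f z + g z) \<le> 2 * sqnorm f + 2 * sqnorm g"
proof -
  have "sqnorm (\<lambda>z. f z + g z) \<le> (LINT z|torus2. 2 * (norm (f z))\<^sup>2 + 2 * (norm (g z))\<^sup>2)"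
    unfolding sqnorm_def
    by (intro integral_mono norm_add_sq_le integrable_mult_right Bochner_Integration.integrable_add
        L2_torusD assms L2_torus_add)
  also have "\<dots> = 2 * sqnorm f + 2 * sqnorm g"
    unfolding sqnorm_def by (simp add: L2_torusD assms)
  finally show ?thesis .
qed

section \<open>Orthonormality of the characters, finite trigonometric sums and Bessel's
  inequality\<close>

lemma integral_monom2: "(LINT z|torus2. monom2 \<alpha> z) = (if \<alpha> = 0 then 1 else 0)"
proof -
  have "integrable torus2 (\<lambda>z. monom2 \<alpha> z * monom2 0 z)"
    by (intro L2_torus_integrable_mult L2_torus_continuous continuous_intros)
  then have "integrable (circle_measure \<Otimes>\<^sub>M circle_measure) (monom2 \<alpha>)"
    by (simp add: monom2_def[abs_def] torus2_def)
  from circle2.integral_fst'[OF this]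
  have "(LINT z|torus2. monom2 \<alpha> z) =
      (LINT x|circle_measure. LINT y|circle_measure. x powi fst \<alpha> * y powi snd \<alpha>)"
    by (simp add: torus2_def monom2_def[abs_def])
  then show ?thesis
    by (simp add: circle_integral_powi prod_eq_iff)
qed

lemma inner_L2_monom2: "inner_L2 (monom2 \<alpha>) (monom2 \<beta>) = (if \<alpha> = \<beta> then 1 else 0)"
proof -
  have "inner_L2 (monom2 \<alpha>) (monom2 \<beta>) = (LINT z|torus2. monom2 (\<alpha> - \<beta>) z)"
    unfolding inner_L2_def
    by (intro Bochner_Integration.integral_cong) (simp_all add: cnj_monom2 monom2_mult del: mem_Times_iff)
  then show ?thesis by (simp add: integral_monom2)
qed

definition trig_sum :: "(int \<times> int \<Rightarrow> complex) \<Rightarrow> (int \<times> int) set \<Rightarrow> complex \<times> complex \<Rightarrow> complex" where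
  "trig_sum c F z = (\<Sum>\<alpha>\<in>F. c \<alpha> * monom2 \<alpha> z)"

lemma continuous_on_trig_sum [continuous_intros]: "continuous_on torus (trig_sum c F)"
  unfolding trig_sum_def by (intro continuous_intros)

lemma inner_L2_trig_sum:
  assumes "finite F" "u \<in> L2_torus"
  shows "inner_L2 u (trig_sum c F) = (\<Sum>\<alpha>\<in>F. cnj (c \<alpha>) * inner_L2 u (monom2 \<alpha>))"
proof -
  have "inner_L2 u (trig_sum c F) = (LINT z|torus2. (\<Sum>\<alpha>\<in>F. cnj (c \<alpha>) * (u z * cnj (monom2 \<alpha> z))))"
    by (simp add: inner_L2_def trig_sum_def sum_distrib_left mult_ac)
  also have "\<dots> = (\<Sum>\<alpha>\<in>F. LINT z|torus2. cnj (c \<alpha>) * (u z * cnj (monom2 \<alpha> z)))"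
    by (intro Bochner_Integration.integral_sum integrable_mult_right L2_torus_integrable_cnj assms
        L2_torus_continuous continuous_intros)
  finally show ?thesis
    by (simp add: inner_L2_def)
qed

lemma inner_L2_trig_sum_monom2:
  assumes "finite F"
  shows "inner_L2 (trig_sum c F) (monom2 \<beta>) = (if \<beta> \<in> F then c \<beta> else 0)"
proof -
  have "inner_L2 (monom2 \<beta>) (trig_sum c F) = (\<Sum>\<alpha>\<in>F. cnj (c \<alpha>) * inner_L2 (monom2 \<beta>) (monom2 \<alpha>))"
    by (intro inner_L2_trig_sum assms L2_torus_continuous continuous_intros)
  also have "\<dots> = (\<Sum>\<alpha>\<in>F. if \<beta> = \<alpha> then cnj (c \<alpha>) else 0)"
    by (intro sum.cong) (auto simp: inner_L2_monom2)
  also have "\<dots> = (if \<beta> \<in> F then cnj (c \<beta>) else 0)"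
    using assms by simp
  finally show ?thesis
    unfolding inner_L2_cnj[of "monom2 \<beta>", symmetric] by simp
qed

text \<open>Completing the square in the coefficients. It contains Bessel (\<open>c\<close> the
  Fourier coefficients), Parseval for finite sums (\<open>u = 0\<close>) and the optimality of
  Fourier sums among all sums over \<open>F\<close>.\<close>

lemma sqnorm_diff_trig_sum:
  fixes u F c
  defines "u_hat \<equiv> \<lambda>\<alpha>. inner_L2 u (monom2 \<alpha>)"
  assumes F: "finite F" and u: "u \<in> L2_torus"
  shows "sqnorm (\<lambda>z. u z - trig_sum c F z) =
    sqnorm u - (\<Sum>\<alpha>\<in>F. (norm (u_hat \<alpha>))\<^sup>2) + (\<Sum>\<alpha>\<in>F. (norm (u_hat \<alpha> - c \<alpha>))\<^sup>2)"
proof -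
  define P where "P = trig_sum c F"
  have P: "P \<in> L2_torus"
    unfolding P_def by (intro L2_torus_continuous continuous_intros)
  have uP: "inner_L2 u P = (\<Sum>\<alpha>\<in>F. cnj (c \<alpha>) * u_hat \<alpha>)"
    unfolding P_def u_hat_def by (rule inner_L2_trig_sum[OF F u])
  have PP: "inner_L2 P P = (\<Sum>\<alpha>\<in>F. cnj (c \<alpha>) * c \<alpha>)"
    unfolding P_def inner_L2_trig_sum[OF F P[unfolded P_def]]
    by (rule sum.cong) (simp_all add: inner_L2_trig_sum_monom2[OF F])
  have Pu: "inner_L2 P u = (\<Sum>\<alpha>\<in>F. c \<alpha> * cnj (u_hat \<alpha>))"
    using arg_cong[OF uP, of cnj] by (simp add: inner_L2_cnj)
  \<comment> \<open>The distance is expanded by sesquilinearity over the complex numbers and read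
    back as a real identity.\<close>
  have "complex_of_real (sqnorm (\<lambda>z. u z - P z)) =
      inner_L2 u u - inner_L2 u P - (inner_L2 P u - inner_L2 P P)"
    by (simp add: inner_L2_diff_left inner_L2_diff_right L2_torus_diff P u flip: inner_L2_self)
  also have "\<dots> = of_real (sqnorm u - (\<Sum>\<alpha>\<in>F. (norm (u_hat \<alpha>))\<^sup>2) + (\<Sum>\<alpha>\<in>F. (norm (u_hat \<alpha> - c \<alpha>))\<^sup>2))"
    unfolding uP PP Pu
    unfolding inner_L2_self of_real_add of_real_diff of_real_sum complex_norm_square
    by (simp add: algebra_simps sum.distrib sum_subtractf)
  finally show ?thesis
    unfolding P_def of_real_eq_iff .
qed

lemma bessel:
  assumes "finite F" "u \<in> L2_torus"
  shows "(\<Sum>\<alpha>\<in>F. (norm (inner_L2 u (monom2 \<alpha>)))\<^sup>2) \<le> sqnorm u"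
  using sqnorm_diff_trig_sum[OF assms, of "\<lambda>\<alpha>. inner_L2 u (monom2 \<alpha>)"]
    sqnorm_nonneg[of "\<lambda>z. u z - trig_sum (\<lambda>\<alpha>. inner_L2 u (monom2 \<alpha>)) F z"]
  by simp

lemma sqnorm_trig_sum:
  assumes "finite F"
  shows "sqnorm (trig_sum c F) = (\<Sum>\<alpha>\<in>F. (norm (c \<alpha>))\<^sup>2)"
  using sqnorm_diff_trig_sum[OF assms, of "\<lambda>_. 0" c]
  by (simp add: sqnorm_def inner_L2_def L2_torus_def)

section \<open>Density of trigonometric polynomials\<close>

definition trig_approximable :: "(complex \<times> complex \<Rightarrow> complex) \<Rightarrow> bool" where
  "trig_approximable f \<longleftrightarrow> f \<in> L2_torus \<and>
     (\<forall>e>0. \<exists>F c. finite F \<and> sqnorm (\<lambda>z. f z - trig_sum c F z) < e)"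

text \<open>Equality is asked on the torus only, because there real and imaginary parts become
  combinations of \<open>w\<close> and \<open>inverse w\<close>.\<close>

definition is_trig :: "(complex \<times> complex \<Rightarrow> complex) \<Rightarrow> bool" where
  "is_trig p \<longleftrightarrow> (\<exists>F c. finite F \<and> (\<forall>z\<in>torus. p z = trig_sum c F z))"

lemma is_trig_monom: "is_trig (\<lambda>z. a * monom2 \<alpha> z)"
  unfolding is_trig_def
  by (rule exI[of _ "{\<alpha>}"], rule exI[of _ "\<lambda>_. a"]) (simp add: trig_sum_def)

lemma is_trig_add:
  assumes "is_trig p" "is_trig q"
  shows "is_trig (\<lambda>z. p z + q z)"
proof -
  obtain F c G d where F: "finite F" "\<And>z. z \<in> torus \<Longrightarrow> p z = trig_sum c F z"
    and G: "finite G" "\<And>z. z \<in> torus \<Longrightarrow> q z = trig_sum d G z"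
    using assms unfolding is_trig_def by metis
  \<comment> \<open>The frequency sets may overlap, so both coefficient families are extended by 0
    and added.\<close>
  define b where "b \<alpha> = (if \<alpha> \<in> F then c \<alpha> else 0) + (if \<alpha> \<in> G then d \<alpha> else 0)" for \<alpha>
  have "p z + q z = trig_sum b (F \<union> G) z" if "z \<in> torus" for z
  proof -
    have "trig_sum c F z = (\<Sum>\<alpha>\<in>F \<union> G. (if \<alpha> \<in> F then c \<alpha> else 0) * monom2 \<alpha> z)"
      unfolding trig_sum_def using F(1) G(1) by (intro sum.mono_neutral_cong_left) auto
    moreover have "trig_sum d G z = (\<Sum>\<alpha>\<in>F \<union> G. (if \<alpha> \<in> G then d \<alpha> else 0) * monom2 \<alpha> z)"
      unfolding trig_sum_def using F(1) G(1) by (intro sum.mono_neutral_cong_left) auto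
    ultimately show ?thesis
      by (simp only: F(2)[OF that] G(2)[OF that] trig_sum_def b_def distrib_right sum.distrib)
  qed
  then show ?thesis
    unfolding is_trig_def using F(1) G(1) by blast
qed

lemma is_trig_cong: "is_trig p \<Longrightarrow> (\<And>z. z \<in> torus \<Longrightarrow> p z = q z) \<Longrightarrow> is_trig q"
  unfolding is_trig_def by metis

lemma is_trig_const: "is_trig (\<lambda>z. a)"
  using is_trig_monom[of a 0] by (simp add: monom2_def)

lemma is_trig_sum: "finite A \<Longrightarrow> (\<And>i. i \<in> A \<Longrightarrow> is_trig (p i)) \<Longrightarrow> is_trig (\<lambda>z. \<Sum>i\<in>A. p i z)"
  by (induction A rule: finite_induct) (auto intro: is_trig_add is_trig_const)

lemma is_trig_mult:
  assumes "is_trig p" "is_trig q"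
  shows "is_trig (\<lambda>z. p z * q z)"
proof -
  obtain F c G d where F: "finite F" "\<And>z. z \<in> torus \<Longrightarrow> p z = trig_sum c F z"
    and G: "finite G" "\<And>z. z \<in> torus \<Longrightarrow> q z = trig_sum d G z"
    using assms unfolding is_trig_def by metis
  \<comment> \<open>Different pairs may give the same frequency \<open>\<alpha> + \<beta>\<close>;
    \<open>is_trig_sum\<close> collects them without an explicit convolution.\<close>
  have "is_trig (\<lambda>z. \<Sum>\<alpha>\<in>F. \<Sum>\<beta>\<in>G. (c \<alpha> * d \<beta>) * monom2 (\<alpha> + \<beta>) z)"
    by (intro is_trig_sum is_trig_monom F G)
  then show ?thesis
  proof (rule is_trig_cong)
    fix z :: "complex \<times> complex" assume z: "z \<in> torus"
    show "(\<Sum>\<alpha>\<in>F. \<Sum>\<beta>\<in>G. (c \<alpha> * d \<beta>) * monom2 (\<alpha> + \<beta>) z) = p z * q z"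
      unfolding F(2)[OF z] G(2)[OF z] trig_sum_def sum_product
      by (intro sum.cong refl) (simp add: monom2_mult[OF z, symmetric])
  qed
qed

text \<open>On the unit circle \<open>inverse w = cnj w\<close>, which yields the four real
  coordinates of the plane as trigonometric polynomials.\<close>

lemma is_trig_Re_Im:
  "is_trig (\<lambda>z. of_real (Re (fst z)))" "is_trig (\<lambda>z. of_real (Im (fst z)))"
  "is_trig (\<lambda>z. of_real (Re (snd z)))" "is_trig (\<lambda>z. of_real (Im (snd z)))"
proof -
  have w: "of_real (Re w) = 1 / 2 * w + 1 / 2 * inverse w"
          "of_real (Im w) = - \<i> / 2 * w + \<i> / 2 * inverse w" if "w \<in> sphere 0 1" for w :: complex
  proof -
    have "inverse w = cnj w"
      using that by (simp add: inverse_eq_divide divide_conv_cnj)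
    then show "of_real (Re w) = 1 / 2 * w + 1 / 2 * inverse w"
          "of_real (Im w) = - \<i> / 2 * w + \<i> / 2 * inverse w"
      by (simp_all add: complex_eq_iff)
  qed
  have t: "is_trig (\<lambda>z. a * monom2 \<alpha> z + b * monom2 \<beta> z)" for a b \<alpha> \<beta>
    by (intro is_trig_add is_trig_monom)
  show "is_trig (\<lambda>z. of_real (Re (fst z)))"
    by (rule is_trig_cong[OF t[of "1/2" "(1, 0)" "1/2" "(-1, 0)"]]) (auto simp: w monom2_def power_int_minus)
  show "is_trig (\<lambda>z. of_real (Im (fst z)))"
    by (rule is_trig_cong[OF t[of "-\<i>/2" "(1, 0)" "\<i>/2" "(-1, 0)"]]) (auto simp: w monom2_def power_int_minus)
  show "is_trig (\<lambda>z. of_real (Re (snd z)))"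
    by (rule is_trig_cong[OF t[of "1/2" "(0, 1)" "1/2" "(0, -1)"]]) (auto simp: w monom2_def power_int_minus)
  show "is_trig (\<lambda>z. of_real (Im (snd z)))"
    by (rule is_trig_cong[OF t[of "-\<i>/2" "(0, 1)" "\<i>/2" "(0, -1)"]]) (auto simp: w monom2_def power_int_minus)
qed

text \<open>The real basis on which the linear functionals in the next induction are
  evaluated.\<close>

lemma complex_pair_expand:
  "(z :: complex \<times> complex) = Re (fst z) *\<^sub>R (1, 0) + (Im (fst z) *\<^sub>R (\<i>, 0) + (Re (snd z) *\<^sub>R (0, 1) + Im (snd z) *\<^sub>R (0, \<i>)))"
proof (rule prod_eqI)
  show "fst z = fst (Re (fst z) *\<^sub>R (1, 0::complex) + (Im (fst z) *\<^sub>R (\<i>, 0) + (Re (snd z) *\<^sub>R (0, 1) + Im (snd z) *\<^sub>R (0, \<i>))))"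
    unfolding fst_add fst_scaleR fst_conv by (rule complex_eqI) simp_all
  show "snd z = snd (Re (fst z) *\<^sub>R (1::complex, 0) + (Im (fst z) *\<^sub>R (\<i>, 0) + (Re (snd z) *\<^sub>R (0, 1) + Im (snd z) *\<^sub>R (0, \<i>))))"
    unfolding snd_add snd_scaleR snd_conv by (rule complex_eqI) simp_all
qed

text \<open>Real polynomial functions are generated by constants and real linear functionals, and
  the latter are real combinations of the four coordinates.\<close>

lemma is_trig_real_polynomial:
  assumes "real_polynomial_function (p :: complex \<times> complex \<Rightarrow> real)"
  shows "is_trig (\<lambda>z. of_real (p z))"
  using assms
proof (induction rule: real_polynomial_function.induct)
  case (linear f)
  interpret bounded_linear f by fact
  have fz: "f z = Re (fst z) * f (1, 0) + (Im (fst z) * f (\<i>, 0) + (Re (snd z) * f (0, 1) + Im (snd z) * f (0, \<i>)))" for z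
  proof -
    have "f z = f (Re (fst z) *\<^sub>R (1, 0) + (Im (fst z) *\<^sub>R (\<i>, 0) + (Re (snd z) *\<^sub>R (0, 1) + Im (snd z) *\<^sub>R (0, \<i>))))"
      by (rule arg_cong[where f = f, OF complex_pair_expand])
    also have "\<dots> = Re (fst z) * f (1, 0) + (Im (fst z) * f (\<i>, 0) + (Re (snd z) * f (0, 1) + Im (snd z) * f (0, \<i>)))"
      unfolding add scaleR real_scaleR_def ..
    finally show ?thesis .
  qed
  have eq: "(\<lambda>z. complex_of_real (f z)) = (\<lambda>z. of_real (Re (fst z)) * of_real (f (1, 0)) + (of_real (Im (fst z)) * of_real (f (\<i>, 0)) +
      (of_real (Re (snd z)) * of_real (f (0, 1)) + of_real (Im (snd z)) * of_real (f (0, \<i>)))))"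
    by (intro ext) (subst fz, simp only: of_real_add of_real_mult)
  show ?case
    unfolding eq by (intro is_trig_add is_trig_mult is_trig_Re_Im is_trig_const)
next
  case (const c)
  show ?case by (rule is_trig_const)
next
  case (add f g)
  then show ?case unfolding of_real_add by (intro is_trig_add)
next
  case (mult f g)
  then show ?case unfolding of_real_mult by (intro is_trig_mult)
qed

lemma sqnorm_cong: "(\<And>z. z \<in> torus \<Longrightarrow> f z = g z) \<Longrightarrow> sqnorm f = sqnorm g"
  unfolding sqnorm_def by (intro Bochner_Integration.integral_cong) auto

lemma sqnorm_le_bound:
  assumes "\<And>z. z \<in> torus \<Longrightarrow> norm (f z) \<le> B" "f \<in> L2_torus"
  shows "sqnorm f \<le> B\<^sup>2"
proof -
  have "sqnorm f \<le> (LINT z|torus2. B\<^sup>2)"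
    unfolding sqnorm_def
    by (intro integral_mono L2_torusD assms) (use assms(1) in \<open>auto intro!: power_mono\<close>)
  then show ?thesis using torus2.prob_space by simp
qed

text \<open>Stone-Weierstrass approximates uniformly, and over a probability measure a uniform error
  bounds the quadratic one.\<close>

lemma trig_approximable_continuous:
  assumes "continuous_on torus f"
  shows "trig_approximable f"
  unfolding trig_approximable_def
proof (intro conjI allI impI)
  show "f \<in> L2_torus" by (rule L2_torus_continuous[OF assms])
  fix e :: real assume "e > 0"
  \<comment> \<open>Chosen so that \<open>d\<^sup>2 = e / 4\<close>, strictly below
    \<open>e\<close>.\<close>
  define d where "d = sqrt e / 2"
  have d: "d > 0" "d\<^sup>2 < e" using \<open>e > 0\<close> by (auto simp: d_def power_divide)
  obtain g where g: "polynomial_function g" "\<And>z. z \<in> torus \<Longrightarrow> norm (f z - g z) < d"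
    using Stone_Weierstrass_polynomial_function[OF compact_torus assms d(1)] by blast
  have "real_polynomial_function (Re \<circ> g)" "real_polynomial_function (Im \<circ> g)"
    using g(1) bounded_linear_Re bounded_linear_Im unfolding polynomial_function_def by blast+
  then have "is_trig (\<lambda>z. of_real ((Re \<circ> g) z) + \<i> * of_real ((Im \<circ> g) z))"
    by (intro is_trig_add is_trig_mult is_trig_const is_trig_real_polynomial)
  then have "is_trig g"
    by (simp flip: complex_eq)
  then obtain F c where F: "finite F" "\<And>z. z \<in> torus \<Longrightarrow> g z = trig_sum c F z"
    unfolding is_trig_def by blast
  have "sqnorm (\<lambda>z. f z - trig_sum c F z) \<le> d\<^sup>2"
  proof (rule sqnorm_le_bound)
    show "norm (f z - trig_sum c F z) \<le> d" if "z \<in> torus" for z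
      using g(2)[OF that] F(2)[OF that] by simp
    show "(\<lambda>z. f z - trig_sum c F z) \<in> L2_torus"
      by (intro L2_torus_continuous continuous_intros assms)
  qed
  with d F(1) show "\<exists>F c. finite F \<and> sqnorm (\<lambda>z. f z - trig_sum c F z) < e"
    by (metis order.strict_trans1)
qed

section \<open>From continuous functions through indicators to all of L2\<close>

lemma trig_approximable_closed:
  assumes f: "f \<in> L2_torus"
    and approx: "\<And>e. e > 0 \<Longrightarrow> \<exists>g. trig_approximable g \<and> sqnorm (\<lambda>z. f z - g z) < e"
  shows "trig_approximable f"
  unfolding trig_approximable_def
proof (intro conjI allI impI f)
  fix e :: real assume "e > 0"
  then obtain g where g: "trig_approximable g" "sqnorm (\<lambda>z. f z - g z) < e / 4"
    using approx[of "e / 4"] by auto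
  then obtain F c where F: "finite F" "sqnorm (\<lambda>z. g z - trig_sum c F z) < e / 4"
    using \<open>e > 0\<close> unfolding trig_approximable_def by (meson divide_pos_pos zero_less_numeral)
  have gL: "g \<in> L2_torus" using g(1) by (simp add: trig_approximable_def)
  have "sqnorm (\<lambda>z. (f z - g z) + (g z - trig_sum c F z)) \<le>
      2 * sqnorm (\<lambda>z. f z - g z) + 2 * sqnorm (\<lambda>z. g z - trig_sum c F z)"
    by (intro sqnorm_add_le L2_torus_diff f gL L2_torus_continuous continuous_intros)
  also have "\<dots> < e"
    using g F by simp
  finally show "\<exists>F c. finite F \<and> sqnorm (\<lambda>z. f z - trig_sum c F z) < e"
    using F(1) by auto
qed

lemma trig_approximable_cong:
  assumes f: "trig_approximable f" and eq: "\<And>z. z \<in> torus \<Longrightarrow> f z = g z"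
    and g: "g \<in> borel_measurable torus2"
  shows "trig_approximable g"
proof (rule trig_approximable_closed)
  have fL: "f \<in> L2_torus" using f by (simp add: trig_approximable_def)
  show "g \<in> L2_torus"
    by (rule L2_torus_dominated[OF g fL, of 1]) (simp add: eq)
  fix e :: real assume "e > 0"
  moreover have "sqnorm (\<lambda>z. g z - f z) = sqnorm (\<lambda>z. 0)"
    by (rule sqnorm_cong) (simp add: eq)
  ultimately show "\<exists>h. trig_approximable h \<and> sqnorm (\<lambda>z. g z - h z) < e"
    using f by (intro exI[of _ f]) (simp add: sqnorm_def)
qed

lemma trig_approximable_add:
  assumes "trig_approximable f" "trig_approximable g"
  shows "trig_approximable (\<lambda>z. f z + g z)"
  unfolding trig_approximable_def
proof (intro conjI allI impI)
  have L: "f \<in> L2_torus" "g \<in> L2_torus" using assms by (auto simp: trig_approximable_def)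
  then show "(\<lambda>z. f z + g z) \<in> L2_torus" by (rule L2_torus_add)
  fix e :: real assume "e > 0"
  then have "e / 4 > 0" by simp
  then obtain F c G d where F: "finite F" "sqnorm (\<lambda>z. f z - trig_sum c F z) < e / 4"
    and G: "finite G" "sqnorm (\<lambda>z. g z - trig_sum d G z) < e / 4"
    using assms unfolding trig_approximable_def by metis
  have "is_trig (\<lambda>z. trig_sum c F z + trig_sum d G z)"
    by (intro is_trig_add) (use F G in \<open>auto simp: is_trig_def\<close>)
  then obtain H b where H: "finite H" "\<And>z. z \<in> torus \<Longrightarrow> trig_sum c F z + trig_sum d G z = trig_sum b H z"
    unfolding is_trig_def by blast
  have "sqnorm (\<lambda>z. (f z + g z) - trig_sum b H z) =
      sqnorm (\<lambda>z. (f z - trig_sum c F z) + (g z - trig_sum d G z))"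
    by (rule sqnorm_cong) (simp flip: H(2))
  also have "\<dots> \<le> 2 * sqnorm (\<lambda>z. f z - trig_sum c F z) + 2 * sqnorm (\<lambda>z. g z - trig_sum d G z)"
    by (intro sqnorm_add_le L2_torus_diff L L2_torus_continuous continuous_intros)
  also have "\<dots> < e" using F G by simp
  finally show "\<exists>F c. finite F \<and> sqnorm (\<lambda>z. (f z + g z) - trig_sum c F z) < e"
    using H(1) by auto
qed

lemma trig_approximable_cmult:
  assumes "trig_approximable f"
  shows "trig_approximable (\<lambda>z. a * f z)"
proof (cases "a = 0")
  case True
  then show ?thesis by (simp add: trig_approximable_continuous)
next
  case False
  show ?thesis
    unfolding trig_approximable_def
  proof (intro conjI allI impI)
    show "(\<lambda>z. a * f z) \<in> L2_torus"
      using assms by (simp add: trig_approximable_def L2_torus_cmult)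
    fix e :: real assume "e > 0"
    with False have "e / (norm a)\<^sup>2 > 0" by simp
    then obtain F c where F: "finite F" "sqnorm (\<lambda>z. f z - trig_sum c F z) < e / (norm a)\<^sup>2"
      using assms unfolding trig_approximable_def by metis
    have "a * f z - trig_sum (\<lambda>\<alpha>. a * c \<alpha>) F z = a * (f z - trig_sum c F z)" for z
      by (simp add: trig_sum_def sum_distrib_left right_diff_distrib mult.assoc)
    then have "sqnorm (\<lambda>z. a * f z - trig_sum (\<lambda>\<alpha>. a * c \<alpha>) F z) =
        (norm a)\<^sup>2 * sqnorm (\<lambda>z. f z - trig_sum c F z)"
      by (simp add: sqnorm_def norm_mult power_mult_distrib)
    also have "\<dots> < e"
      using F(2) False by (simp add: field_simps)
    finally show "\<exists>F c. finite F \<and> sqnorm (\<lambda>z. a * f z - trig_sum c F z) < e"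
      using F(1) by blast
  qed
qed

lemma trig_approximable_sum:
  "finite A \<Longrightarrow> (\<And>i. i \<in> A \<Longrightarrow> trig_approximable (f i)) \<Longrightarrow> trig_approximable (\<lambda>z. \<Sum>i\<in>A. f i z)"
  by (induction A rule: finite_induct) (auto intro: trig_approximable_add trig_approximable_continuous)

text \<open>Dominated convergence: the bound by \<open>w\<close> passes to the limit
  \<open>f\<close>, so \<open>(2 * norm (w z))\<^sup>2\<close> majorises the squared
  differences.\<close>

lemma trig_approximable_limit:
  assumes g: "\<And>n. trig_approximable (g n)" and f: "f \<in> borel_measurable torus2"
    and w: "w \<in> L2_torus" "\<And>n z. z \<in> torus \<Longrightarrow> norm (g n z) \<le> norm (w z)"
    and lim: "\<And>z. z \<in> torus \<Longrightarrow> (\<lambda>n. g n z) \<longlonglongrightarrow> f z"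
  shows "trig_approximable f"
proof (rule trig_approximable_closed)
  have fw: "norm (f z) \<le> norm (w z)" if "z \<in> torus" for z
    by (rule LIMSEQ_le_const2[OF tendsto_norm[OF lim[OF that]]]) (use w(2)[OF that] in auto)
  then show fL: "f \<in> L2_torus"
    by (intro L2_torus_dominated[OF f w(1), of 1]) simp
  have gL: "g n \<in> L2_torus" for n
    using g by (simp add: trig_approximable_def)
  have "(\<lambda>n. sqnorm (\<lambda>z. f z - g n z)) \<longlonglongrightarrow> (LINT z|torus2. 0)"
    unfolding sqnorm_def
  proof (rule integral_dominated_convergence)
    show "integrable torus2 (\<lambda>z. (2 * norm (w z))\<^sup>2)"
      unfolding power_mult_distrib by (intro integrable_mult_right L2_torusD w)
    show "AE z in torus2. norm ((norm (f z - g n z))\<^sup>2) \<le> (2 * norm (w z))\<^sup>2" for n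
    proof (intro AE_I2)
      fix z assume "z \<in> space torus2"
      then have z: "z \<in> torus" by simp
      have "norm (f z - g n z) \<le> 2 * norm (w z)"
        using norm_triangle_ineq4[of "f z" "g n z"] fw[OF z] w(2)[OF z, of n] by linarith
      then have "(norm (f z - g n z))\<^sup>2 \<le> (2 * norm (w z))\<^sup>2"
        by (intro power_mono) auto
      then show "norm ((norm (f z - g n z))\<^sup>2) \<le> (2 * norm (w z))\<^sup>2"
        by simp
    qed
    show "AE z in torus2. (\<lambda>n. (norm (f z - g n z))\<^sup>2) \<longlonglongrightarrow> 0"
    proof (intro AE_I2)
      fix z assume "z \<in> space torus2"
      then have "(\<lambda>n. (norm (f z - g n z))\<^sup>2) \<longlonglongrightarrow> (norm (f z - f z))\<^sup>2"
        by (intro tendsto_intros lim) simp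
      then show "(\<lambda>n. (norm (f z - g n z))\<^sup>2) \<longlonglongrightarrow> 0" by simp
    qed
    show "(\<lambda>z. (norm (f z - g n z))\<^sup>2) \<in> borel_measurable torus2" for n
      using L2_torusD(2)[OF L2_torus_diff[OF fL gL[of n]]] by (rule borel_measurable_integrable)
  qed simp
  then have conv: "(\<lambda>n. sqnorm (\<lambda>z. f z - g n z)) \<longlonglongrightarrow> 0" by simp
  fix e :: real assume "e > 0"
  obtain n where "sqnorm (\<lambda>z. f z - g n z) < e"
    using eventually_happens'[OF sequentially_bot order_tendstoD(2)[OF conv \<open>e > 0\<close>]] by blast
  with g show "\<exists>g. trig_approximable g \<and> sqnorm (\<lambda>z. f z - g z) < e"
    by blast
qed

lemma measurable_ident_torus2: "(\<lambda>z. z) \<in> torus2 \<rightarrow>\<^sub>M borel"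
  by (simp add: measurable_cong_sets[OF sets_torus2 refl] measurable_restrict_space1)

lemma measurable_indicator_torus2:
  assumes "A \<in> sets borel"
  shows "(\<lambda>z. complex_of_real (indicator A z)) \<in> borel_measurable torus2"
proof -
  have "complex_of_real \<in> borel \<rightarrow>\<^sub>M borel"
    by (intro borel_measurable_continuous_onI continuous_intros)
  from measurable_compose[OF measurable_compose[OF measurable_ident_torus2
        borel_measurable_indicator[OF assms]] this]
  show ?thesis .
qed

text \<open>Powers of \<open>1 / (1 + infdist z C)\<close> are continuous, stay 1 on
  \<open>C\<close> and tend to 0 off \<open>C\<close>.\<close>

lemma trig_approximable_indicator_closed:
  assumes "closed C"
  shows "trig_approximable (\<lambda>z. of_real (indicator C z))"
\<comment> \<open>By convention \<open>infdist\<close> to the empty set is 0, so the powers would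
  tend to 1 instead of 0 there.\<close>
proof (cases "C = {}")
  case True
  then show ?thesis by (simp add: trig_approximable_continuous)
next
  case False
  define g where "g n z = complex_of_real ((1 / (1 + infdist z C)) ^ n)" for n :: nat and z
  have nn: "0 \<le> infdist z C" for z by (rule infdist_nonneg)
  have pos: "1 + infdist z C \<noteq> 0" for z using nn[of z] by linarith
  show ?thesis
  proof (rule trig_approximable_limit[where g=g and w="\<lambda>_. 1"])
    have cont: "continuous_on torus (\<lambda>z. 1 / (1 + infdist z C))"
      using pos by (intro continuous_on_divide continuous_on_add continuous_on_const
          continuous_on_infdist continuous_on_id) blast
    have "continuous_on torus (\<lambda>z. complex_of_real ((1 / (1 + infdist z C)) ^ n))" for n
      by (rule continuous_on_of_real) (rule continuous_on_power[OF cont])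
    then have "continuous_on torus (g n)" for n
      unfolding g_def[abs_def] .
    then show "trig_approximable (g n)" for n
      by (rule trig_approximable_continuous)
    show "(\<lambda>z. complex_of_real (indicator C z)) \<in> borel_measurable torus2"
      by (rule measurable_indicator_torus2[OF borel_closed[OF assms]])
    show "(\<lambda>_. 1) \<in> L2_torus"
      by (intro L2_torus_continuous continuous_intros)
    show "norm (g n z) \<le> norm (1::complex)" for n z
    proof -
      have "0 \<le> 1 / (1 + infdist z C)" "1 / (1 + infdist z C) \<le> 1"
        using nn[of z] by (simp_all add: field_simps)
      then have "(1 / (1 + infdist z C)) ^ n \<le> 1" "0 \<le> (1 / (1 + infdist z C)) ^ n"
        by (auto intro: power_le_one)
      then show ?thesis unfolding g_def norm_of_real by simp
    qed
    show "(\<lambda>n. g n z) \<longlonglongrightarrow> complex_of_real (indicator C z)" for z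
    proof (cases "z \<in> C")
      case True
      then show ?thesis by (simp add: g_def)
    next
      case notin: False
      then have "infdist z C > 0"
        using nn[of z] in_closed_iff_infdist_zero[OF assms False, of z] by auto
      then have "(\<lambda>n. (1 / (1 + infdist z C)) ^ n) \<longlonglongrightarrow> 0"
        by (intro LIMSEQ_realpow_zero) (auto simp: field_simps)
      from tendsto_of_real[OF this] notin show ?thesis
        by (simp add: g_def del: of_real_power)
    qed
  qed
qed

text \<open>Dynkin's argument: closed sets form an intersection-stable generator. Complements are
  affine operations on indicators, and partial sums over disjoint sets converge under the majorant
  1.\<close>

lemma trig_approximable_indicator_borel:
  assumes "C \<in> sets borel"
  shows "trig_approximable (\<lambda>z. of_real (indicator C z))"
proof -
  have borel: "sigma_sets UNIV (Collect closed) = sets (borel :: (complex \<times> complex) measure)"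
    by (simp add: borel_eq_closed)
  have "Int_stable (Collect closed)" "Collect closed \<subseteq> Pow UNIV" "C \<in> sigma_sets UNIV (Collect closed)"
    using assms by (auto simp: Int_stable_def borel_eq_closed)
  then show ?thesis
  proof (induction C rule: sigma_sets_induct_disjoint)
    case (basic A)
    then show ?case by (simp add: trig_approximable_indicator_closed)
  next
    case empty
    then show ?case by (simp add: trig_approximable_continuous)
  next
    case (compl A)
    have "trig_approximable (\<lambda>z. 1 + (-1) * of_real (indicator A z))"
      by (intro trig_approximable_add trig_approximable_cmult compl trig_approximable_continuous continuous_intros)
    then show ?case
      by (simp add: indicator_diff)
  next
    case (union A)
    show ?case
    proof (rule trig_approximable_limit[where w="\<lambda>_. 1" and g="\<lambda>n z. \<Sum>i<n. of_real (indicator (A i) z)"])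
      show "trig_approximable (\<lambda>z. \<Sum>i<n. of_real (indicator (A i) z))" for n
        by (intro trig_approximable_sum union) auto
      show "(\<lambda>z. complex_of_real (indicator (\<Union> (range A)) z)) \<in> borel_measurable torus2"
        by (rule measurable_indicator_torus2) (use union in \<open>auto simp: borel\<close>)
      show "(\<lambda>_. 1) \<in> L2_torus"
        by (intro L2_torus_continuous continuous_intros)
      have s: "(\<lambda>i. indicat_real (A i) z) sums indicator (\<Union> (range A)) z" for z
        by (rule indicator_sums) (use union(1) in \<open>auto simp: disjoint_family_on_def\<close>)
      have "(\<lambda>n. complex_of_real (\<Sum>i<n. indicat_real (A i) z)) \<longlonglongrightarrow> of_real (indicator (\<Union> (range A)) z)" for z
        by (rule tendsto_of_real) (use s[of z] in \<open>simp add: sums_def\<close>)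
      then show "(\<lambda>n. \<Sum>i<n. complex_of_real (indicator (A i) z)) \<longlonglongrightarrow> of_real (indicator (\<Union> (range A)) z)" for z
        by simp
      show "norm (\<Sum>i<n. complex_of_real (indicator (A i) z)) \<le> norm (1::complex)" for n z
      proof -
        have "(\<Sum>i<n. indicat_real (A i) z) \<le> indicator (\<Union> (range A)) z"
          using sum_le_suminf[OF sums_summable[OF s[of z]], of "{..<n}"] sums_unique[OF s[of z]] by simp
        also have "\<dots> \<le> 1" by (simp add: indicator_def)
        finally have "\<bar>\<Sum>i<n. indicat_real (A i) z\<bar> \<le> 1"
          by (simp add: sum_nonneg)
        then show ?thesis
          by (simp flip: of_real_sum)
      qed
    qed
  qed
qed

text \<open>Completeness of the trigonometric system. Simple functions, which are finite
  combinations of indicators, converge to \<open>f\<close> pointwise and are dominated by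
  \<open>2 * norm (f z)\<close>.\<close>

theorem L2_imp_trig_approximable:
  assumes f: "f \<in> L2_torus"
  shows "trig_approximable f"
proof -
  obtain s where s: "\<And>i. simple_function torus2 (s i)"
    and lim: "\<And>z. z \<in> space torus2 \<Longrightarrow> (\<lambda>i. s i z) \<longlonglongrightarrow> f z"
    and bound: "\<And>i z. z \<in> space torus2 \<Longrightarrow> dist (s i z) 0 \<le> 2 * dist (f z) 0"
    using borel_measurable_implies_sequence_metric[OF L2_torusD(1)[OF f], of 0] by blast
  have ind: "trig_approximable (\<lambda>z. of_real (indicator X z))" if X: "X \<in> sets torus2" for X
  proof -
    obtain C where C: "C \<in> sets borel" "X = torus \<inter> C"
      using X by (auto simp: sets_torus2 sets_restrict_space)
    \<comment> \<open>The torus is itself Borel, so a trace of a Borel set on it is a Borel set of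
      the plane.\<close>
    have "closed torus"
      by (rule compact_imp_closed[OF compact_torus])
    then show ?thesis
      unfolding C(2) by (intro trig_approximable_indicator_borel sets.Int C(1)) auto
  qed
  have dense: "trig_approximable (s i)" for i
  proof -
    let ?t = "\<lambda>z. \<Sum>y\<in>s i ` space torus2. y * of_real (indicator (s i -` {y} \<inter> space torus2) z)"
    have t: "trig_approximable ?t"
      by (intro trig_approximable_sum trig_approximable_cmult ind simple_functionD s)
    have eq: "s i z = ?t z" if "z \<in> torus" for z
    proof -
      have "s i z = (\<Sum>y\<in>s i ` space torus2. indicator (s i -` {y} \<inter> space torus2) z *\<^sub>R y)"
        by (rule simple_function_indicator_representation_banach[OF s]) (simp only: space_torus2 that)
      also have "\<dots> = ?t z"
        by (intro sum.cong refl) (simp only: scaleR_conv_of_real mult.commute)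
      finally show ?thesis .
    qed
    show ?thesis
    proof (rule trig_approximable_cong[OF t])
      show "?t z = s i z" if "z \<in> torus" for z
        by (rule eq[OF that, symmetric])
      show "s i \<in> borel_measurable torus2"
        by (rule borel_measurable_simple_function[OF s])
    qed
  qed
  show ?thesis
  proof (rule trig_approximable_limit[where g = s and w = "\<lambda>z. 2 * f z"])
    show "norm (s i z) \<le> norm (2 * f z)" if "z \<in> torus" for i z
      using bound[of z i] that by (simp add: norm_mult)
    show "(\<lambda>i. s i z) \<longlonglongrightarrow> f z" if "z \<in> torus" for z
      using lim[of z] that by simp
  qed (fact dense L2_torusD(1)[OF f] L2_torus_cmult[OF f])+
qed

section \<open>Hankel operators with homogeneous symbol\<close>

text \<open>A weighted arithmetic-geometric bound in place of Cauchy-Schwarz; the free weight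
  \<open>d\<close> is later tied to the approximation error.\<close>

lemma norm_inner_L2_le:
  assumes "v \<in> L2_torus" "w \<in> L2_torus" "d > 0"
  shows "norm (inner_L2 v w) \<le> (d * sqnorm v + sqnorm w / d) / 2"
proof -
  have int: "integrable torus2 (\<lambda>z. (d / 2) * (norm (v z))\<^sup>2)" "integrable torus2 (\<lambda>z. (1 / (2 * d)) * (norm (w z))\<^sup>2)"
    by (intro integrable_mult_right L2_torusD assms)+
  have le: "norm (v z * cnj (w z)) \<le> (d / 2) * (norm (v z))\<^sup>2 + (1 / (2 * d)) * (norm (w z))\<^sup>2" for z
  proof -
    have "0 \<le> (d * norm (v z) - norm (w z))\<^sup>2 / (2 * d)"
      using assms(3) by simp
    also have "\<dots> = (d / 2) * (norm (v z))\<^sup>2 + (1 / (2 * d)) * (norm (w z))\<^sup>2 - norm (v z) * norm (w z)"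
      using assms(3) by (simp add: field_simps power2_eq_square)
    finally show ?thesis by (simp add: norm_mult)
  qed
  have "norm (inner_L2 v w) \<le> (LINT z|torus2. norm (v z * cnj (w z)))"
    unfolding inner_L2_def by (rule integral_norm_bound)
  also have "\<dots> \<le> (LINT z|torus2. (d / 2) * (norm (v z))\<^sup>2 + (1 / (2 * d)) * (norm (w z))\<^sup>2)"
    by (intro integral_mono integrable_norm L2_torus_integrable_cnj assms
        Bochner_Integration.integrable_add int le)
  also have "\<dots> = (LINT z|torus2. (d / 2) * (norm (v z))\<^sup>2) + (LINT z|torus2. (1 / (2 * d)) * (norm (w z))\<^sup>2)"
    by (rule Bochner_Integration.integral_add[OF int])
  also have "\<dots> = (d * sqnorm v + sqnorm w / d) / 2"
    by (simp add: sqnorm_def field_simps)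
  finally show ?thesis .
qed

lemma H2_imp_L2: "f \<in> H2 \<Longrightarrow> f \<in> L2_torus"
  by (simp add: H2_def)

lemma H2_coeff:
  assumes "f \<in> H2" "\<not> (0 \<le> fst \<alpha> \<and> 0 \<le> snd \<alpha>)"
  shows "inner_L2 f (monom2 \<alpha>) = 0"
proof -
  have "fourier_coeff f (fst \<alpha>) (snd \<alpha>) = 0"
    using assms unfolding H2_def by blast
  then show ?thesis by (simp add: fourier_coeff_eq)
qed

text \<open>Completeness enters here: \<open>u\<close> is a limit of finite sums of characters to
  each of which \<open>v\<close> is orthogonal.\<close>

lemma H2_orthogonal:
  assumes v: "v \<in> L2_torus" and u: "u \<in> H2"
    and zero: "\<And>\<alpha>. 0 \<le> fst \<alpha> \<Longrightarrow> 0 \<le> snd \<alpha> \<Longrightarrow> inner_L2 v (monom2 \<alpha>) = 0"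
  shows "inner_L2 v u = 0"
proof -
  have uL: "u \<in> L2_torus" by (rule H2_imp_L2[OF u])
  have bound: "norm (inner_L2 v u) \<le> d * ((sqnorm v + 1) / 2)" if d: "d > 0" for d
  proof -
    \<comment> \<open>The error is taken as \<open>d\<^sup>2\<close> because the weighted bound
      divides it by \<open>d\<close>.\<close>
    obtain F c where F: "finite F" "sqnorm (\<lambda>z. u z - trig_sum c F z) < d\<^sup>2"
      using L2_imp_trig_approximable[OF uL] d unfolding trig_approximable_def by (meson zero_less_power)
    \<comment> \<open>Replacing an arbitrary approximant by the partial Fourier sum over the same frequencies does
      not increase the error, and keeps all frequencies in the positive quadrant.\<close>
    define S where "S = trig_sum (\<lambda>\<alpha>. inner_L2 u (monom2 \<alpha>)) F"
    have S: "S \<in> L2_torus"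
      unfolding S_def by (rule L2_torus_continuous[OF continuous_on_trig_sum])
    have "sqnorm (\<lambda>z. u z - S z) \<le> sqnorm (\<lambda>z. u z - trig_sum c F z)"
      unfolding S_def sqnorm_diff_trig_sum[OF F(1) uL] by (simp add: sum_nonneg)
    with F(2) have small: "sqnorm (\<lambda>z. u z - S z) \<le> d\<^sup>2" by simp
    have "cnj (inner_L2 u (monom2 \<alpha>)) * inner_L2 v (monom2 \<alpha>) = 0" for \<alpha>
      using zero[of \<alpha>] H2_coeff[OF u, of \<alpha>] by auto
    then have "inner_L2 v S = 0"
      unfolding S_def inner_L2_trig_sum[OF F(1) v] by (intro sum.neutral ballI)
    then have "inner_L2 v u = inner_L2 v (\<lambda>z. u z - S z)"
      by (simp add: inner_L2_diff_right uL S v)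
    also have "norm \<dots> \<le> (d * sqnorm v + sqnorm (\<lambda>z. u z - S z) / d) / 2"
      by (intro norm_inner_L2_le v L2_torus_diff uL S d)
    also have "\<dots> \<le> (d * sqnorm v + d\<^sup>2 / d) / 2"
      using small d by (simp add: divide_right_mono)
    also have "\<dots> = d * ((sqnorm v + 1) / 2)"
      using d by (simp add: field_simps power2_eq_square)
    finally show ?thesis .
  qed
  have "norm (inner_L2 v u) \<le> 0 + e" if "e > 0" for e
  proof -
    have K: "(sqnorm v + 1) / 2 > 0" using add_nonneg_pos[OF sqnorm_nonneg[of v] zero_less_one] by (rule half_gt_zero)
    show ?thesis
      using bound[OF divide_pos_pos[OF that K]] K by simp
  qed
  then have "norm (inner_L2 v u) \<le> 0" by (rule field_le_epsilon)
  then show ?thesis by simp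
qed

lemma inner_L2_cnj_cnj: "inner_L2 (\<lambda>z. cnj (f z)) (\<lambda>z. cnj (g z)) = cnj (inner_L2 f g)"
  unfolding inner_L2_def
  by (subst Bochner_Integration.integral_cnj[symmetric], rule Bochner_Integration.integral_cong) simp_all

lemma trig_sum_H2:
  assumes "finite F" "\<And>\<alpha>. \<alpha> \<in> F \<Longrightarrow> 0 \<le> fst \<alpha> \<and> 0 \<le> snd \<alpha>"
  shows "trig_sum c F \<in> H2"
  unfolding H2_def
proof (intro CollectI conjI allI impI)
  show "trig_sum c F \<in> L2_torus"
    by (rule L2_torus_continuous[OF continuous_on_trig_sum])
  fix m n assume "fourier_coeff (trig_sum c F) m n \<noteq> 0"
  then have "(m, n) \<in> F"
    unfolding fourier_coeff_eq inner_L2_trig_sum_monom2[OF assms(1)] by (auto split: if_splits)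
  from assms(2)[OF this] show "0 \<le> m" "0 \<le> n" by simp_all
qed

text \<open>The finitely many coefficients give an explicit projection \<open>T\<close>, so the
  choice has an instance. The chosen function is fixed only up to a null set, and its norm is found
  by comparing inner products with \<open>T\<close>.\<close>

lemma norm_L2_proj_conj_H2:
  assumes g: "g \<in> L2_torus" and I: "finite I" "\<And>\<alpha>. \<alpha> \<in> I \<Longrightarrow> 0 \<le> fst \<alpha> \<and> 0 \<le> snd \<alpha>"
    and coeff: "\<And>\<alpha>. 0 \<le> fst \<alpha> \<Longrightarrow> 0 \<le> snd \<alpha> \<Longrightarrow>
      inner_L2 (\<lambda>z. cnj (g z)) (monom2 \<alpha>) = (if \<alpha> \<in> I then A \<alpha> else 0)"
  shows "norm_L2 (proj_conj_H2 g) = sqrt (\<Sum>\<alpha>\<in>I. (norm (A \<alpha>))\<^sup>2)"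
proof -
  define P where "P = trig_sum A I"
  define T where "T = (\<lambda>z. cnj (P z))"
  have P: "P \<in> H2" unfolding P_def by (rule trig_sum_H2[OF I])
  have T: "T \<in> conj_H2" unfolding T_def conj_H2_def using P by (rule imageI)
  have L2: "h \<in> L2_torus" if "h \<in> conj_H2" for h
    using that unfolding conj_H2_def by (auto intro: L2_torus_cnj H2_imp_L2)
  have orth: "inner_L2 (\<lambda>z. g z - T z) h = 0" if "h \<in> conj_H2" for h
  proof -
    obtain u where u: "u \<in> H2" and h: "h = (\<lambda>z. cnj (u z))"
      using \<open>h \<in> conj_H2\<close> unfolding conj_H2_def by auto
    have "inner_L2 (\<lambda>z. cnj (g z) - P z) u = 0"
    proof (rule H2_orthogonal[OF _ u])
      show "(\<lambda>z. cnj (g z) - P z) \<in> L2_torus"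
        by (intro L2_torus_diff L2_torus_cnj g H2_imp_L2 P)
      fix \<alpha> :: "int \<times> int" assume "0 \<le> fst \<alpha>" "0 \<le> snd \<alpha>"
      then show "inner_L2 (\<lambda>z. cnj (g z) - P z) (monom2 \<alpha>) = 0"
        using coeff[of \<alpha>] inner_L2_trig_sum_monom2[OF I(1), of A \<alpha>]
          inner_L2_diff_left[OF L2_torus_cnj[OF g] H2_imp_L2[OF P]
            L2_torus_continuous[OF continuous_on_monom2[of \<alpha>]]]
        by (simp add: P_def)
    qed
    then show ?thesis
      using inner_L2_cnj_cnj[of "\<lambda>z. cnj (g z) - P z" u] by (simp add: h T_def)
  qed
  define g' where "g' = proj_conj_H2 g"
  have "g' \<in> conj_H2 \<and> (\<forall>h\<in>conj_H2. inner_L2 (\<lambda>z. g z - g' z) h = 0)"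
    unfolding g'_def proj_conj_H2_def by (rule someI[of _ T]) (use T orth in blast)
  then have g': "g' \<in> conj_H2" "\<And>h. h \<in> conj_H2 \<Longrightarrow> inner_L2 (\<lambda>z. g z - g' z) h = 0"
    by auto
  have eq: "inner_L2 g' h = inner_L2 T h" if h: "h \<in> conj_H2" for h
    using orth[OF h] g'(2)[OF h]
    by (simp add: inner_L2_diff_left[OF g L2[OF T] L2[OF h]] inner_L2_diff_left[OF g L2[OF g'(1)] L2[OF h]])
  \<comment> \<open>Both \<open>g'\<close> and \<open>T\<close> lie in \<open>conj_H2\<close> and
    have the same inner products with its members; testing against each of them equates their
    norms.\<close>
  have "inner_L2 g' g' = cnj (inner_L2 g' T)"
    unfolding inner_L2_cnj by (rule eq[OF g'(1)])
  also have "\<dots> = inner_L2 T T"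
    unfolding eq[OF T] by (rule inner_L2_cnj)
  finally have "sqnorm g' = sqnorm T"
    unfolding inner_L2_self of_real_eq_iff .
  also have "\<dots> = sqnorm P"
    by (simp add: sqnorm_def T_def)
  also have "\<dots> = (\<Sum>\<alpha>\<in>I. (norm (A \<alpha>))\<^sup>2)"
    unfolding P_def by (rule sqnorm_trig_sum[OF I(1)])
  finally show ?thesis
    unfolding norm_L2_eq g'_def by simp
qed

section \<open>Homogeneous symbols and their decomposition into Hankel blocks\<close>

text \<open>Coefficients are indexed by the power of the first variable. They are real, which makes
  the blocks real matrices; the same form also supplies the test functions.\<close>

definition homog :: "(nat \<Rightarrow> real) \<Rightarrow> nat \<Rightarrow> complex \<times> complex \<Rightarrow> complex" where
  "homog c d z = (\<Sum>j\<le>d. of_real (c j) * fst z ^ j * snd z ^ (d - j))"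

lemma homog_monom2: "homog c d z = (\<Sum>j\<le>d. of_real (c j) * monom2 (int j, int (d - j)) z)"
  by (simp add: homog_def monom2_def mult.assoc del: of_nat_diff)

lemma continuous_on_homog: "continuous_on torus (homog c d)"
  unfolding homog_def by (intro continuous_intros)

lemma homog_trig_sum:
  "homog c d = trig_sum (\<lambda>\<alpha>. of_real (c (nat (fst \<alpha>)))) ((\<lambda>j. (int j, int (d - j))) ` {..d})"
proof
  fix z
  have "inj_on (\<lambda>j. (int j, int (d - j))) {..d}"
    by (auto simp: inj_on_def)
  then show "homog c d z = trig_sum (\<lambda>\<alpha>. of_real (c (nat (fst \<alpha>)))) ((\<lambda>j. (int j, int (d - j))) ` {..d}) z"
    by (simp add: homog_monom2 trig_sum_def sum.reindex del: of_nat_diff)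
qed

lemma sqnorm_homog: "sqnorm (homog c d) = (\<Sum>j\<le>d. (c j)\<^sup>2)"
proof -
  have "inj_on (\<lambda>j. (int j, int (d - j))) {..d}"
    by (auto simp: inj_on_def)
  then show ?thesis
    unfolding homog_trig_sum by (subst sqnorm_trig_sum) (simp_all add: sum.reindex del: of_nat_diff)
qed

text \<open>Each monomial of the symbol shifts the frequency at which \<open>f\<close> is
  tested.\<close>

lemma inner_L2_homog_mult:
  assumes f: "f \<in> L2_torus"
  shows "inner_L2 (\<lambda>z. homog c d z * cnj (f z)) (monom2 \<alpha>) =
    (\<Sum>j\<le>d. of_real (c j) * cnj (inner_L2 f (monom2 ((int j, int (d - j)) - \<alpha>))))"
proof -
  let ?e = "\<lambda>j. (int j, int (d - j)) - \<alpha>"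
  have eq: "homog c d z * cnj (f z) * cnj (monom2 \<alpha> z) =
      (\<Sum>j\<le>d. of_real (c j) * (monom2 (?e j) z * cnj (f z)))" if "z \<in> torus" for z
  proof -
    have "monom2 (?e j) z = monom2 (int j, int (d - j)) z * cnj (monom2 \<alpha> z)" for j
      unfolding cnj_monom2[OF that] monom2_mult[OF that] by simp
    then show ?thesis
      by (simp add: homog_monom2 sum_distrib_left sum_distrib_right mult_ac del: of_nat_diff)
  qed
  have "inner_L2 (\<lambda>z. homog c d z * cnj (f z)) (monom2 \<alpha>) =
      (LINT z|torus2. (\<Sum>j\<le>d. of_real (c j) * (monom2 (?e j) z * cnj (f z))))"
    unfolding inner_L2_def by (rule Bochner_Integration.integral_cong[OF refl]) (rule eq, simp)
  also have "\<dots> = (\<Sum>j\<le>d. LINT z|torus2. of_real (c j) * (monom2 (?e j) z * cnj (f z)))"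
    by (intro Bochner_Integration.integral_sum integrable_mult_right L2_torus_integrable_cnj f
        L2_torus_continuous continuous_on_monom2)
  also have "\<dots> = (\<Sum>j\<le>d. of_real (c j) * inner_L2 (monom2 (?e j)) f)"
    unfolding inner_L2_def by simp
  finally show ?thesis
    unfolding inner_L2_cnj .
qed

text \<open>Conjugated output of degree \<open>d - k\<close> sees only the coefficients of
  \<open>f\<close> of degree \<open>k\<close>, so the square of the norm splits over
  \<open>k\<close>. The entry in row \<open>p\<close> and column \<open>m\<close> is
  \<open>c (p + m)\<close>.\<close>

lemma norm_L2_hankel_homog:
  assumes f: "f \<in> H2"
  shows "norm_L2 (hankel (homog c d) f) = sqrt (\<Sum>k\<le>d. \<Sum>p\<le>d - k.
    (norm (\<Sum>m\<le>k. of_real (c (p + m)) * inner_L2 f (monom2 (int m, int (k - m)))))\<^sup>2)"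
proof -
  \<comment> \<open>The output frequencies fill the triangle of total degree at most
    \<open>d\<close>, listed by the input degree \<open>k\<close> and the first exponent
    \<open>p\<close>.\<close>
  define I where "I = (\<lambda>(k, p). (int p, int (d - k - p))) ` (SIGMA k:{..d}. {..d - k})"
  define A where "A \<alpha> = inner_L2 (\<lambda>z. homog c d z * cnj (f z)) (monom2 \<alpha>)" for \<alpha>
  have fL: "f \<in> L2_torus" by (rule H2_imp_L2[OF f])
  have A: "A \<alpha> = (\<Sum>j\<le>d. of_real (c j) * cnj (inner_L2 f (monom2 ((int j, int (d - j)) - \<alpha>))))" for \<alpha>
    unfolding A_def by (rule inner_L2_homog_mult[OF fL])
  have outside: "A \<alpha> = 0" if "0 \<le> fst \<alpha>" "0 \<le> snd \<alpha>" "\<alpha> \<notin> I" for \<alpha>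
    unfolding A
  proof (intro sum.neutral ballI)
    fix j assume j: "j \<in> {..d}"
    have "\<not> (0 \<le> fst ((int j, int (d - j)) - \<alpha>) \<and> 0 \<le> snd ((int j, int (d - j)) - \<alpha>))"
    proof
      assume *: "0 \<le> fst ((int j, int (d - j)) - \<alpha>) \<and> 0 \<le> snd ((int j, int (d - j)) - \<alpha>)"
      obtain p q where pq: "\<alpha> = (int p, int q)"
        using \<open>0 \<le> fst \<alpha>\<close> \<open>0 \<le> snd \<alpha>\<close> by (metis nonneg_int_cases prod.collapse)
      have "p + q \<le> d" using * j unfolding pq by auto
      \<comment> \<open>The input degree is what the output leaves of the symbol degree:
        \<open>k = d - (p + q)\<close>.\<close>
      then have "\<alpha> \<in> I"
        unfolding I_def pq by (intro image_eqI[of _ _ "(d - (p + q), p)"]) auto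
      with that show False by simp
    qed
    from H2_coeff[OF f this]
    show "of_real (c j) * cnj (inner_L2 f (monom2 ((int j, int (d - j)) - \<alpha>))) = 0" by simp
  qed
  have "norm_L2 (hankel (homog c d) f) = sqrt (\<Sum>\<alpha>\<in>I. (norm (A \<alpha>))\<^sup>2)"
    unfolding hankel_def
  proof (rule norm_L2_proj_conj_H2)
    have "continuous_on torus (\<lambda>z. cnj (homog c d z))"
      by (intro continuous_on_cnj continuous_on_homog)
    then show "(\<lambda>z. cnj (homog c d z) * f z) \<in> L2_torus"
      by (rule L2_torus_mult_continuous[OF _ fL])
    show "inner_L2 (\<lambda>z. cnj (cnj (homog c d z) * f z)) (monom2 \<alpha>) = (if \<alpha> \<in> I then A \<alpha> else 0)"
      if "0 \<le> fst \<alpha>" "0 \<le> snd \<alpha>" for \<alpha>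
      using outside[OF that] by (simp add: A_def)
  qed (auto simp: I_def)
  also have "(\<Sum>\<alpha>\<in>I. (norm (A \<alpha>))\<^sup>2) =
      (\<Sum>(k, p)\<in>(SIGMA k:{..d}. {..d - k}). (norm (A (int p, int (d - k - p))))\<^sup>2)"
  proof -
    have "inj_on (\<lambda>(k, p). (int p, int (d - k - p))) (SIGMA k:{..d}. {..d - k})"
      by (auto simp: inj_on_def)
    then show ?thesis
      unfolding I_def by (simp only: sum.reindex comp_def case_prod_unfold)
  qed
  also have "\<dots> = (\<Sum>k\<le>d. \<Sum>p\<le>d - k. (norm (A (int p, int (d - k - p))))\<^sup>2)"
    by (simp add: sum.Sigma del: of_nat_diff)
  also have "\<dots> = (\<Sum>k\<le>d. \<Sum>p\<le>d - k.
    (norm (\<Sum>m\<le>k. of_real (c (p + m)) * inner_L2 f (monom2 (int m, int (k - m)))))\<^sup>2)"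
  proof (intro sum.cong refl)
    fix k p assume "k \<in> {..d}" "p \<in> {..d - k}"
    then have kp: "k + p \<le> d" by auto
    let ?t = "\<lambda>j. of_real (c j) * cnj (inner_L2 f (monom2 ((int j, int (d - j)) - (int p, int (d - k - p)))))"
    \<comment> \<open>The tested frequency is \<open>(j - p, p + k - j)\<close>, which leaves the
      quadrant unless \<open>p \<le> j \<le> p + k\<close>.\<close>
    have "A (int p, int (d - k - p)) = (\<Sum>j\<in>{p..p + k}. ?t j)"
      unfolding A
    proof (intro sum.mono_neutral_right ballI)
      fix j assume j: "j \<in> {..d} - {p..p + k}"
      have "\<not> (0 \<le> fst ((int j, int (d - j)) - (int p, int (d - k - p))) \<and>
          0 \<le> snd ((int j, int (d - j)) - (int p, int (d - k - p))))"
        using j kp by auto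
      from H2_coeff[OF f this] show "?t j = 0" by simp
    qed (use kp in auto)
    also have "\<dots> = (\<Sum>m\<le>k. ?t (p + m))"
      by (rule sum.reindex_bij_witness[of _ "\<lambda>m. p + m" "\<lambda>j. j - p"]) auto
    also have "\<dots> = (\<Sum>m\<le>k. of_real (c (p + m)) * cnj (inner_L2 f (monom2 (int m, int (k - m)))))"
    proof (intro sum.cong refl)
      fix m assume "m \<in> {..k}"
      with kp have "(int (p + m), int (d - (p + m))) - (int p, int (d - k - p)) = (int m, int (k - m))"
        by auto
      then show "?t (p + m) = of_real (c (p + m)) * cnj (inner_L2 f (monom2 (int m, int (k - m))))"
        by simp
    qed
    \<comment> \<open>As \<open>c\<close> is real, conjugation moves outside the sum and disappears
      in the norm.\<close>
    also have "\<dots> = cnj (\<Sum>m\<le>k. of_real (c (p + m)) * inner_L2 f (monom2 (int m, int (k - m))))"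
      by simp
    finally show "(norm (A (int p, int (d - k - p))))\<^sup>2 =
        (norm (\<Sum>m\<le>k. of_real (c (p + m)) * inner_L2 f (monom2 (int m, int (k - m)))))\<^sup>2"
      by (simp only: complex_mod_cnj)
  qed
  finally show ?thesis .
qed

section \<open>Block norms and the criterion for minimality\<close>

text \<open>A real matrix acts separately on real and imaginary parts, so a bound on real vectors
  carries over with the same constant.\<close>

lemma complex_sum_square_le:
  fixes c :: "nat \<Rightarrow> real" and x :: "nat \<Rightarrow> complex"
  assumes "\<And>y :: nat \<Rightarrow> real. (\<Sum>p\<le>n. (\<Sum>m\<le>k. c (p + m) * y m)\<^sup>2) \<le> S * (\<Sum>m\<le>k. (y m)\<^sup>2)"
  shows "(\<Sum>p\<le>n. (norm (\<Sum>m\<le>k. of_real (c (p + m)) * x m))\<^sup>2) \<le> S * (\<Sum>m\<le>k. (norm (x m))\<^sup>2)"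
proof -
  have "(\<Sum>p\<le>n. (norm (\<Sum>m\<le>k. of_real (c (p + m)) * x m))\<^sup>2) =
      (\<Sum>p\<le>n. (\<Sum>m\<le>k. c (p + m) * Re (x m))\<^sup>2) + (\<Sum>p\<le>n. (\<Sum>m\<le>k. c (p + m) * Im (x m))\<^sup>2)"
    by (simp add: cmod_power2 sum.distrib)
  also have "\<dots> \<le> S * (\<Sum>m\<le>k. (Re (x m))\<^sup>2) + S * (\<Sum>m\<le>k. (Im (x m))\<^sup>2)"
    by (intro add_mono assms)
  also have "\<dots> = S * (\<Sum>m\<le>k. (norm (x m))\<^sup>2)"
    by (simp add: cmod_power2 sum.distrib distrib_left)
  finally show ?thesis .
qed

text \<open>Bessel on the triangle of frequencies of degree at most \<open>d\<close>, grouped by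
  degree.\<close>

lemma homog_coeff_norm_le:
  assumes "f \<in> L2_torus"
  shows "(\<Sum>k\<le>d. \<Sum>m\<le>k. (norm (inner_L2 f (monom2 (int m, int (k - m)))))\<^sup>2) \<le> sqnorm f"
proof -
  define J where "J = (\<lambda>(k, m). (int m, int (k - m))) ` (SIGMA k:{..d}. {..k})"
  have "inj_on (\<lambda>(k, m). (int m, int (k - m))) (SIGMA k:{..d}. {..k})"
    by (auto simp: inj_on_def)
  then have "(\<Sum>k\<le>d. \<Sum>m\<le>k. (norm (inner_L2 f (monom2 (int m, int (k - m)))))\<^sup>2) =
      (\<Sum>\<alpha>\<in>J. (norm (inner_L2 f (monom2 \<alpha>)))\<^sup>2)"
    unfolding J_def by (simp add: sum.reindex comp_def case_prod_unfold sum.Sigma del: of_nat_diff)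
  also have "\<dots> \<le> sqnorm f"
    by (rule bessel[OF _ assms]) (simp add: J_def)
  finally show ?thesis .
qed

text \<open>A homogeneous polynomial of degree \<open>k\<close> excites block \<open>k\<close>
  alone, so every real vector in that block is realised by a function in \<open>H2\<close>.\<close>

lemma hankel_homog_test:
  fixes x :: "nat \<Rightarrow> real"
  assumes k: "k \<le> d"
  obtains f where "f \<in> H2" "sqnorm f = (\<Sum>m\<le>k. (x m)\<^sup>2)"
    "norm_L2 (hankel (homog c d) f) = sqrt (\<Sum>p\<le>d - k. (\<Sum>m\<le>k. c (p + m) * x m)\<^sup>2)"
proof
  let ?f = "homog x k"
  have inj: "inj_on (\<lambda>j. (int j, int (k - j))) {..k}"
    by (auto simp: inj_on_def)
  show H2: "?f \<in> H2"
    unfolding homog_trig_sum by (rule trig_sum_H2) auto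
  show "sqnorm ?f = (\<Sum>m\<le>k. (x m)\<^sup>2)" by (rule sqnorm_homog)
  have coeff: "inner_L2 ?f (monom2 (int m, int (l - m))) = (if l = k then of_real (x m) else 0)"
    if "m \<le> l" for l m
    unfolding homog_trig_sum using that by (subst inner_L2_trig_sum_monom2) auto
  have "(\<Sum>l\<le>d. \<Sum>p\<le>d - l.
      (norm (\<Sum>m\<le>l. of_real (c (p + m)) * inner_L2 ?f (monom2 (int m, int (l - m)))))\<^sup>2) =
      (\<Sum>l\<le>d. if l = k then (\<Sum>p\<le>d - k. (\<Sum>m\<le>k. c (p + m) * x m)\<^sup>2) else 0)"
  proof (intro sum.cong refl)
    fix l
    show "(\<Sum>p\<le>d - l. (norm (\<Sum>m\<le>l. of_real (c (p + m)) * inner_L2 ?f (monom2 (int m, int (l - m)))))\<^sup>2) =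
        (if l = k then (\<Sum>p\<le>d - k. (\<Sum>m\<le>k. c (p + m) * x m)\<^sup>2) else 0)"
    proof (cases "l = k")
      case True
      have "(\<Sum>m\<le>k. of_real (c (p + m)) * inner_L2 ?f (monom2 (int m, int (k - m)))) =
          complex_of_real (\<Sum>m\<le>k. c (p + m) * x m)" for p
        unfolding of_real_sum of_real_mult by (intro sum.cong refl) (simp add: coeff del: of_nat_diff)
      then show ?thesis
        unfolding True by (simp only: norm_of_real power2_abs if_True simp_thms)
    next
      case False
      have "(\<Sum>m\<le>l. of_real (c (p + m)) * inner_L2 ?f (monom2 (int m, int (l - m)))) = 0" for p
        by (intro sum.neutral ballI) (use False in \<open>simp add: coeff del: of_nat_diff\<close>)
      then show ?thesis using False by (simp del: of_nat_diff)
    qed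
  qed
  also have "\<dots> = (\<Sum>p\<le>d - k. (\<Sum>m\<le>k. c (p + m) * x m)\<^sup>2)"
    using k by simp
  finally show "norm_L2 (hankel (homog c d) ?f) = sqrt (\<Sum>p\<le>d - k. (\<Sum>m\<le>k. c (p + m) * x m)\<^sup>2)"
    unfolding norm_L2_hankel_homog[OF H2] by (rule arg_cong)
qed

lemma norm_inner_L2_monom2_le:
  assumes "f \<in> L2_torus"
  shows "norm (inner_L2 f (monom2 \<alpha>)) \<le> norm_L2 f"
  using bessel[OF _ assms, of "{\<alpha>}"] by (simp add: norm_L2_eq real_le_rsqrt)

text \<open>Without boundedness the real supremum would not dominate its members. All Fourier
  coefficients on the unit ball have modulus at most 1, and a crude row bound is enough.\<close>

lemma bdd_above_hankel_homog:
  "bdd_above ((\<lambda>f. norm_L2 (hankel (homog c d) f)) ` {f \<in> H2. norm_L2 f \<le> 1})"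
proof (rule bdd_aboveI2)
  fix f assume f: "f \<in> {f \<in> H2. norm_L2 f \<le> 1}"
  have le1: "norm (inner_L2 f (monom2 \<alpha>)) \<le> 1" for \<alpha>
    using norm_inner_L2_monom2_le[OF H2_imp_L2, of f \<alpha>] f by simp
  have "norm (\<Sum>m\<le>k. of_real (c (p + m)) * inner_L2 f (monom2 (int m, int (k - m)))) \<le> (\<Sum>m\<le>k. \<bar>c (p + m)\<bar>)" for k p
  proof (intro sum_norm_le)
    fix m
    show "norm (of_real (c (p + m)) * inner_L2 f (monom2 (int m, int (k - m)))) \<le> \<bar>c (p + m)\<bar>"
      using mult_left_mono[OF le1, of "\<bar>c (p + m)\<bar>" "(int m, int (k - m))"]
      unfolding norm_mult norm_of_real by simp
  qed
  then show "norm_L2 (hankel (homog c d) f) \<le> sqrt (\<Sum>k\<le>d. \<Sum>p\<le>d - k. (\<Sum>m\<le>k. \<bar>c (p + m)\<bar>)\<^sup>2)"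
    using f by (subst norm_L2_hankel_homog) (auto intro!: real_sqrt_le_mono sum_mono power_mono)
qed

text \<open>If the norm is minimal, normalised test polynomials yield each block inequality.
  Conversely, the block inequalities are added and Bessel bounds the total.\<close>

theorem hankel_minimal_norm_homog_iff:
  fixes c :: "nat \<Rightarrow> real"
  shows "hankel_minimal_norm (homog c d) \<longleftrightarrow>
    (\<forall>k\<le>d. \<forall>x :: nat \<Rightarrow> real.
      (\<Sum>p\<le>d - k. (\<Sum>m\<le>k. c (p + m) * x m)\<^sup>2) \<le> (\<Sum>j\<le>d. (c j)\<^sup>2) * (\<Sum>m\<le>k. (x m)\<^sup>2))"
proof
  define S where "S = (\<Sum>j\<le>d. (c j)\<^sup>2)"
  have nrm: "norm_L2 (homog c d) = sqrt S"
    by (simp add: norm_L2_eq sqnorm_homog S_def)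
  have upper: "norm_L2 (hankel (homog c d) f) \<le> hankel_norm (homog c d)"
    if "f \<in> H2" "norm_L2 f \<le> 1" for f
    unfolding hankel_norm_def by (rule cSUP_upper[OF _ bdd_above_hankel_homog]) (use that in simp)
  {
    assume "hankel_minimal_norm (homog c d)"
    then have min: "hankel_norm (homog c d) = sqrt S"
      by (simp add: hankel_minimal_norm_def nrm)
    show "\<forall>k\<le>d. \<forall>x :: nat \<Rightarrow> real. (\<Sum>p\<le>d - k. (\<Sum>m\<le>k. c (p + m) * x m)\<^sup>2) \<le> S * (\<Sum>m\<le>k. (x m)\<^sup>2)"
    proof (intro allI impI)
      fix k :: nat and x :: "nat \<Rightarrow> real" assume k: "k \<le> d"
      define r where "r = sqrt (\<Sum>m\<le>k. (x m)\<^sup>2)"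
      have r2: "r\<^sup>2 = (\<Sum>m\<le>k. (x m)\<^sup>2)" unfolding r_def by (simp add: sum_nonneg)
      show "(\<Sum>p\<le>d - k. (\<Sum>m\<le>k. c (p + m) * x m)\<^sup>2) \<le> S * (\<Sum>m\<le>k. (x m)\<^sup>2)"
      proof (cases "r = 0")
        case True
        then have "(\<Sum>m\<le>k. (x m)\<^sup>2) = 0" using r2 by simp
        then have "x m = 0" if "m \<le> k" for m
          using that by (simp add: sum_nonneg_eq_0_iff)
        then show ?thesis by simp
      next
        case False
        \<comment> \<open>Dividing by \<open>r\<close> gives a test function of norm 1; homogeneity
          restores the factor \<open>r\<^sup>2\<close>.\<close>
        obtain f where f: "f \<in> H2" "sqnorm f = (\<Sum>m\<le>k. (x m / r)\<^sup>2)"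
          "norm_L2 (hankel (homog c d) f) = sqrt (\<Sum>p\<le>d - k. (\<Sum>m\<le>k. c (p + m) * (x m / r))\<^sup>2)"
          using hankel_homog_test[OF k, of "\<lambda>m. x m / r" c] by blast
        have "sqnorm f = 1"
          unfolding f(2) power_divide sum_divide_distrib[symmetric] r2[symmetric] using False by simp
        then have "norm_L2 f \<le> 1" by (simp add: norm_L2_eq)
        from upper[OF f(1) this] have "(\<Sum>p\<le>d - k. (\<Sum>m\<le>k. c (p + m) * (x m / r))\<^sup>2) \<le> S"
          unfolding f(3) min by simp
        moreover have "(\<Sum>p\<le>d - k. (\<Sum>m\<le>k. c (p + m) * (x m / r))\<^sup>2) =
            (\<Sum>p\<le>d - k. (\<Sum>m\<le>k. c (p + m) * x m)\<^sup>2) / r\<^sup>2"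
          by (simp add: power_divide flip: sum_divide_distrib)
        ultimately show ?thesis
          using False unfolding r2[symmetric] by (simp add: divide_le_eq)
      qed
    qed
  next
    assume *: "\<forall>k\<le>d. \<forall>x :: nat \<Rightarrow> real. (\<Sum>p\<le>d - k. (\<Sum>m\<le>k. c (p + m) * x m)\<^sup>2) \<le> S * (\<Sum>m\<le>k. (x m)\<^sup>2)"
    have S: "0 \<le> S" by (simp add: S_def sum_nonneg)
    \<comment> \<open>Block \<open>k = 0\<close> on the vector 1 returns the whole coefficient
      column. This gives the lower bound \<open>sqrt S\<close> and shows that the unit ball is
      nonempty.\<close>
    obtain f where f: "f \<in> H2" "sqnorm f = (\<Sum>m\<le>0::nat. 1\<^sup>2)"
      "norm_L2 (hankel (homog c d) f) = sqrt (\<Sum>p\<le>d - 0. (\<Sum>m\<le>0. c (p + m) * 1)\<^sup>2)"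
      by (rule hankel_homog_test[of 0 d "\<lambda>_. 1" c]) auto
    then have f1: "norm_L2 f \<le> 1" by (simp add: norm_L2_eq)
    have "hankel_norm (homog c d) \<le> sqrt S"
      unfolding hankel_norm_def
    proof (rule cSUP_least)
      show "{f \<in> H2. norm_L2 f \<le> 1} \<noteq> {}" using f f1 by blast
      fix g assume g: "g \<in> {f \<in> H2. norm_L2 f \<le> 1}"
      then have gL: "g \<in> L2_torus" and g1: "sqnorm g \<le> 1"
        by (auto simp: norm_L2_eq H2_imp_L2)
      \<comment> \<open>One constant \<open>S\<close> serves every block, so only the sum of squared
        coefficients of \<open>g\<close> remains to be bounded.\<close>
      have "(\<Sum>k\<le>d. \<Sum>p\<le>d - k. (norm (\<Sum>m\<le>k. of_real (c (p + m)) * inner_L2 g (monom2 (int m, int (k - m)))))\<^sup>2)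
          \<le> (\<Sum>k\<le>d. S * (\<Sum>m\<le>k. (norm (inner_L2 g (monom2 (int m, int (k - m)))))\<^sup>2))"
        by (intro sum_mono complex_sum_square_le) (use * in auto)
      also have "\<dots> \<le> S * sqnorm g"
        unfolding sum_distrib_left[symmetric] by (intro mult_left_mono homog_coeff_norm_le gL S)
      also have "\<dots> \<le> S" using mult_left_mono[OF g1 S] by simp
      finally show "norm_L2 (hankel (homog c d) g) \<le> sqrt S"
        using g by (simp add: norm_L2_hankel_homog del: of_nat_diff)
    qed
    moreover have "sqrt S \<le> hankel_norm (homog c d)"
      using upper[OF f(1) f1] by (simp add: f(3) S_def)
    ultimately show "hankel_minimal_norm (homog c d)"
      by (simp add: hankel_minimal_norm_def nrm)
  }
qed

section \<open>The quadratic and the cubic symbol\<close>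

lemma phi2_homog: "phi2 a = homog (\<lambda>j. if j = 1 then a else 1) 2"
  by (simp add: fun_eq_iff phi2_def homog_def numeral_2_eq_2 split_beta)

lemma phi3_homog: "phi3 b = homog (\<lambda>j. if j = 1 \<or> j = 2 then b else 1) 3"
  by (simp add: fun_eq_iff phi3_def homog_def eval_nat_numeral split_beta)

lemma hankel_minimal_norm_phi2:
  fixes a :: real
  assumes "0 \<le> a"
  shows "hankel_minimal_norm (phi2 a) \<longleftrightarrow> a \<le> 1 / 2"
proof
  assume "hankel_minimal_norm (phi2 a)"
  from this[unfolded phi2_homog hankel_minimal_norm_homog_iff, rule_format, of 1 "\<lambda>_. 1"]
  \<comment> \<open>Both rows of the block with rows \<open>(1, a)\<close> and \<open>(a, 1)\<close>
    send \<open>(1, 1)\<close> to \<open>1 + a\<close>; after cancelling,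
    \<open>4 * a \<le> 2\<close> remains.\<close>
  have "2 * (1 + a)\<^sup>2 \<le> 2 * (2 + a\<^sup>2)"
    by (simp add: eval_nat_numeral algebra_simps)
  then show "a \<le> 1 / 2" by (simp add: power2_eq_square algebra_simps)
next
  assume a: "a \<le> 1 / 2"
  show "hankel_minimal_norm (phi2 a)"
    unfolding phi2_homog hankel_minimal_norm_homog_iff
  proof (intro allI impI)
    fix k :: nat and x :: "nat \<Rightarrow> real" assume "k \<le> 2"
    then consider "k = 0" | "k = 1" | "k = 2" by linarith
    then show "(\<Sum>p\<le>2 - k. (\<Sum>m\<le>k. (if p + m = 1 then a else 1) * x m)\<^sup>2)
      \<le> (\<Sum>j\<le>2::nat. (if j = 1 then a else 1)\<^sup>2) * (\<Sum>m\<le>k. (x m)\<^sup>2)"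
    proof cases
      case 1
      then show ?thesis by (simp add: eval_nat_numeral algebra_simps)
    next
      case 2
      \<comment> \<open>The deficit is written so that the first term vanishes at the extremal
        direction \<open>(1, 1)\<close> and the second carries the threshold.\<close>
      have "(2 + a\<^sup>2) * ((x 0)\<^sup>2 + (x 1)\<^sup>2) - ((x 0 + a * x 1)\<^sup>2 + (a * x 0 + x 1)\<^sup>2) =
          2 * a * (x 0 - x 1)\<^sup>2 + (1 - 2 * a) * ((x 0)\<^sup>2 + (x 1)\<^sup>2)"
        by (simp add: power2_eq_square algebra_simps)
      also have "\<dots> \<ge> 0" using a assms by simp
      finally show ?thesis using 2 by (simp add: eval_nat_numeral algebra_simps)
    next
      case 3
      \<comment> \<open>The block is the single row \<open>(1, a, 1)\<close>, and this is Lagrange's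
        identity for Cauchy-Schwarz.\<close>
      have "(2 + a\<^sup>2) * ((x 0)\<^sup>2 + (x 1)\<^sup>2 + (x 2)\<^sup>2) - (x 0 + a * x 1 + x 2)\<^sup>2 =
          (a * x 0 - x 1)\<^sup>2 + (x 0 - x 2)\<^sup>2 + (x 1 - a * x 2)\<^sup>2"
        by (simp add: power2_eq_square algebra_simps)
      also have "\<dots> \<ge> 0" by simp
      finally show ?thesis using 3 by (simp add: eval_nat_numeral algebra_simps)
    qed
  qed
qed

lemma hankel_minimal_norm_phi3:
  fixes b :: real
  assumes "0 \<le> b"
  shows "hankel_minimal_norm (phi3 b) \<longleftrightarrow> b \<le> sqrt 2 - 1"
proof -
  \<comment> \<open>For \<open>b \<ge> 0\<close> squaring \<open>b + 1 \<le> sqrt 2\<close> is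
    reversible, which gives a polynomial threshold.\<close>
  have iff: "b \<le> sqrt 2 - 1 \<longleftrightarrow> b\<^sup>2 + 2 * b \<le> 1"
  proof -
    have "b \<le> sqrt 2 - 1 \<longleftrightarrow> b + 1 \<le> sqrt 2" by linarith
    also have "\<dots> \<longleftrightarrow> (b + 1)\<^sup>2 \<le> 2"
      using assms by (metis add_nonneg_nonneg real_le_rsqrt real_sqrt_le_iff real_sqrt_unique zero_le_one)
    finally show ?thesis by (simp add: power2_eq_square algebra_simps)
  qed
  show ?thesis
    unfolding iff
  proof
    assume "hankel_minimal_norm (phi3 b)"
    from this[unfolded phi3_homog hankel_minimal_norm_homog_iff, rule_format, of 1 "\<lambda>_. 1"]
    \<comment> \<open>The block \<open>k = 1\<close> has rows \<open>(1, b)\<close>,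
      \<open>(b, b)\<close>, \<open>(b, 1)\<close>, with values \<open>1 + b\<close>,
      \<open>2 * b\<close>, \<open>1 + b\<close> at \<open>(1, 1)\<close>.\<close>
    have "2 * (1 + b)\<^sup>2 + (2 * b)\<^sup>2 \<le> 2 * (2 + 2 * b\<^sup>2)"
      by (simp add: eval_nat_numeral algebra_simps)
    then show "b\<^sup>2 + 2 * b \<le> 1" by (simp add: power2_eq_square algebra_simps)
  next
    assume b: "b\<^sup>2 + 2 * b \<le> 1"
    show "hankel_minimal_norm (phi3 b)"
      unfolding phi3_homog hankel_minimal_norm_homog_iff
    proof (intro allI impI)
      fix k :: nat and x :: "nat \<Rightarrow> real" assume "k \<le> 3"
      then consider "k = 0" | "k = 1" | "k = 2" | "k = 3" by linarith
      then show "(\<Sum>p\<le>3 - k. (\<Sum>m\<le>k. (if p + m = 1 \<or> p + m = 2 then b else 1) * x m)\<^sup>2)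
        \<le> (\<Sum>j\<le>3::nat. (if j = 1 \<or> j = 2 then b else 1)\<^sup>2) * (\<Sum>m\<le>k. (x m)\<^sup>2)"
      proof cases
        case 1
        then show ?thesis by (simp add: eval_nat_numeral algebra_simps)
      next
        case 2
        \<comment> \<open>As in the quadratic case, the first term vanishes at \<open>(1, 1)\<close>
          and the second is the threshold.\<close>
        have "(2 + 2 * b\<^sup>2) * ((x 0)\<^sup>2 + (x 1)\<^sup>2) - ((x 0 + b * x 1)\<^sup>2 + (b * x 0 + b * x 1)\<^sup>2 + (b * x 0 + x 1)\<^sup>2) =
            (2 * b + b\<^sup>2) * (x 0 - x 1)\<^sup>2 + (1 - (b\<^sup>2 + 2 * b)) * ((x 0)\<^sup>2 + (x 1)\<^sup>2)"
          by (simp add: power2_eq_square algebra_simps)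
        also have "\<dots> \<ge> 0" using b assms by simp
        finally show ?thesis using 2 by (simp add: eval_nat_numeral algebra_simps)
      next
        case 3
        \<comment> \<open>This block is the transpose of the previous one. The first two squares
          vanish at \<open>(1 + b, 2 * b, 1 + b)\<close>, the image of \<open>(1, 1)\<close> under
          block \<open>k = 1\<close>; doubling clears fractions.\<close>
        have "2 * ((2 + 2 * b\<^sup>2) * ((x 0)\<^sup>2 + (x 1)\<^sup>2 + (x 2)\<^sup>2) -
              ((x 0 + b * x 1 + b * x 2)\<^sup>2 + (b * x 0 + b * x 1 + x 2)\<^sup>2)) =
            2 * (b * (x 0 + x 2) - (1 + b) * x 1)\<^sup>2 + (2 * b\<^sup>2 + 4 * b) * (x 0 - x 2)\<^sup>2 +
            2 * (1 - (b\<^sup>2 + 2 * b)) * ((x 0)\<^sup>2 + (x 1)\<^sup>2 + (x 2)\<^sup>2)"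
          by (simp add: power2_eq_square algebra_simps)
        also have "\<dots> \<ge> 0" using b assms by simp
        finally show ?thesis using 3 by (simp add: eval_nat_numeral algebra_simps)
      next
        case 4
        \<comment> \<open>Lagrange's identity for the single row
          \<open>(1, b, b, 1)\<close>.\<close>
        have "(2 + 2 * b\<^sup>2) * ((x 0)\<^sup>2 + (x 1)\<^sup>2 + (x 2)\<^sup>2 + (x 3)\<^sup>2) - (x 0 + b * x 1 + b * x 2 + x 3)\<^sup>2 =
            (b * x 0 - x 1)\<^sup>2 + (b * x 0 - x 2)\<^sup>2 + (x 0 - x 3)\<^sup>2 + (b * x 1 - b * x 2)\<^sup>2 +
            (x 1 - b * x 3)\<^sup>2 + (x 2 - b * x 3)\<^sup>2"
          by (simp add: power2_eq_square algebra_simps)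
        also have "\<dots> \<ge> 0" by simp
        finally show ?thesis using 4 by (simp add: eval_nat_numeral algebra_simps)
      qed
    qed
  qed
qed

theorem theorem10:
  fixes a b :: real
  assumes "0 \<le> a" and "0 \<le> b"
  shows "(hankel_minimal_norm (phi2 a) \<longleftrightarrow> a \<le> 1 / 2) \<and>
         (hankel_minimal_norm (phi3 b) \<longleftrightarrow> b \<le> sqrt 2 - 1)"
  using hankel_minimal_norm_phi2[OF assms(1)] hankel_minimal_norm_phi3[OF assms(2)] by blast

end
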